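(* There exist finite-dimensional complex vector spaces $\mathcal{A}_1,\mathcal{B}_1,\mathcal{C}_1,\mathcal{A}_2,\mathcal{B}_2,\mathcal{C}_2$ and tensors $\mathcal{T}_1\in\mathcal{A}_1\otimes\mathcal{B}_1\otimes\mathcal{C}_1$ and $\mathcal{T}_2\in\mathcal{A}_2\otimes\mathcal{B}_2\otimes\mathcal{C}_2$ such that $$\mathbf{R}(\mathcal{T}_1\oplus\mathcal{T}_2)<\mathbf{R}(\mathcal{T}_1)+\mathbf{R}(\mathcal{T}_2).$$
   Context: All vector spaces are finite-dimensional over $\mathbb{C}$. The rank $\mathbf{R}(T)$ of a tensor $T\in A\otimes B\otimes C$ is the minimum number $r\ge 0$ such that $T=\sum_{i=1}^r a_i\otimes b_i\otimes c_i$ with $a_i\in A$, $b_i\in B$, $c_i\in C$. For $\mathcal{T}_j\in \mathcal{A}_j\otimes \mathcal{B}_j\otimes \mathcal{C}_j$ ($j=1,2$), the direct sum $\mathcal{T}_1\oplus \mathcal{T}_2$ is the sum of $\mathcal{T}_1$ and $\mathcal{T}_2$ regarded as an element of $(\mathcal{A}_1\oplus \mathcal{A}_2)\otimes(\mathcal{B}_1\oplus \mathcal{B}_2)\otimes(\mathcal{C}_1\oplus \mathcal{C}_2)$ via the natural inclusions. *)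

theory Defs
  imports Complex_Main "HOL-Library.Function_Algebras"
begin

text \<open>
  Vector spaces are subspaces of a space of functions from an index type to the complex
  numbers; every finite-dimensional complex vector space is isomorphic to one over the index
  type \<^typ>\<open>nat\<close>. Addition of functions is pointwise, from
  \<^theory>\<open>HOL-Library.Function_Algebras\<close>.
\<close>

definition fscale :: "complex \<Rightarrow> ('i \<Rightarrow> complex) \<Rightarrow> 'i \<Rightarrow> complex" where
  "fscale c f = (\<lambda>i. c * f i)"

global_interpretation fvec: vector_space fscale
  by unfold_locales (auto simp: fscale_def fun_eq_iff algebra_simps)

definition fd_space :: "('i \<Rightarrow> complex) set \<Rightarrow> bool" where
  "fd_space A \<longleftrightarrow> fvec.subspace A \<and> (\<exists>S. finite S \<and> A = fvec.span S)"

definition tensor :: "('i \<Rightarrow> complex) \<Rightarrow> ('j \<Rightarrow> complex) \<Rightarrow> ('k \<Rightarrow> complex) \<Rightarrow> 'i \<times> 'j \<times> 'k \<Rightarrow> complex"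
  where "tensor a b c = (\<lambda>(i, j, k). a i * b j * c k)"

text \<open>
  For function spaces the abstract tensor product embeds into the functions on the product of
  the index types, so it can be taken to be the span of the elementary tensors there. Lemma
  \<open>tensor_independent\<close> below is the injectivity of this embedding.
\<close>

definition tensor_space ::
  "('i \<Rightarrow> complex) set \<Rightarrow> ('j \<Rightarrow> complex) set \<Rightarrow> ('k \<Rightarrow> complex) set \<Rightarrow> ('i \<times> 'j \<times> 'k \<Rightarrow> complex) set"
  where "tensor_space A B C = fvec.span {tensor a b c | a b c. a \<in> A \<and> b \<in> B \<and> c \<in> C}"

definition tensor_rank ::
  "('i \<Rightarrow> complex) set \<Rightarrow> ('j \<Rightarrow> complex) set \<Rightarrow> ('k \<Rightarrow> complex) set \<Rightarrow> ('i \<times> 'j \<times> 'k \<Rightarrow> complex) \<Rightarrow> nat"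
  where "tensor_rank A B C T =
    (LEAST r. \<exists>a b c. (\<forall>s<r. a s \<in> A \<and> b s \<in> B \<and> c s \<in> C) \<and>
                      T = (\<Sum>s<r. tensor (a s) (b s) (c s)))"

definition inl_vec :: "('i \<Rightarrow> complex) \<Rightarrow> 'i + 'i' \<Rightarrow> complex" where
  "inl_vec a = case_sum a (\<lambda>_. 0)"

definition inr_vec :: "('i' \<Rightarrow> complex) \<Rightarrow> 'i + 'i' \<Rightarrow> complex" where
  "inr_vec a = case_sum (\<lambda>_. 0) a"

definition dsum_space ::
  "('i \<Rightarrow> complex) set \<Rightarrow> ('i' \<Rightarrow> complex) set \<Rightarrow> ('i + 'i' \<Rightarrow> complex) set" where
  "dsum_space A A' = {inl_vec a + inr_vec a' | a a'. a \<in> A \<and> a' \<in> A'}"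

text \<open>
  The inclusions of tensor spaces induced by \<^const>\<open>inl_vec\<close> and \<^const>\<open>inr_vec\<close> in all
  three factors: extension by zero.
\<close>

definition inl_tensor ::
  "('i \<times> 'j \<times> 'k \<Rightarrow> complex) \<Rightarrow> ('i + 'i') \<times> ('j + 'j') \<times> ('k + 'k') \<Rightarrow> complex" where
  "inl_tensor T = (\<lambda>p. case p of (Inl i, Inl j, Inl k) \<Rightarrow> T (i, j, k) | _ \<Rightarrow> 0)"

definition inr_tensor ::
  "('i' \<times> 'j' \<times> 'k' \<Rightarrow> complex) \<Rightarrow> ('i + 'i') \<times> ('j + 'j') \<times> ('k + 'k') \<Rightarrow> complex" where
  "inr_tensor T = (\<lambda>p. case p of (Inr i, Inr j, Inr k) \<Rightarrow> T (i, j, k) | _ \<Rightarrow> 0)"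

definition dsum_tensor ::
  "('i \<times> 'j \<times> 'k \<Rightarrow> complex) \<Rightarrow> ('i' \<times> 'j' \<times> 'k' \<Rightarrow> complex)
    \<Rightarrow> ('i + 'i') \<times> ('j + 'j') \<times> ('k + 'k') \<Rightarrow> complex" where
  "dsum_tensor T T' = inl_tensor T + inr_tensor T'"

lemma inl_tensor_tensor: "inl_tensor (tensor a b c) = tensor (inl_vec a) (inl_vec b) (inl_vec c)"
  by (auto simp: inl_tensor_def tensor_def inl_vec_def fun_eq_iff split: sum.splits)

lemma inr_tensor_tensor: "inr_tensor (tensor a b c) = tensor (inr_vec a) (inr_vec b) (inr_vec c)"
  by (auto simp: inr_tensor_def tensor_def inr_vec_def fun_eq_iff split: sum.splits)

lemma inl_tensor_linear:
  "inl_tensor (T + T') = inl_tensor T + inl_tensor T'"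
  "inl_tensor (fscale x T) = fscale x (inl_tensor T)"
  by (auto simp: inl_tensor_def fscale_def fun_eq_iff split: sum.splits)

lemma inr_tensor_linear:
  "inr_tensor (T + T') = inr_tensor T + inr_tensor T'"
  "inr_tensor (fscale x T) = fscale x (inr_tensor T)"
  by (auto simp: inr_tensor_def fscale_def fun_eq_iff split: sum.splits)

lemma sum_fun_apply: "(\<Sum>x\<in>X. f x) i = (\<Sum>x\<in>X. f x i)" for f :: "'x \<Rightarrow> 'i \<Rightarrow> complex"
  by (induction X rule: infinite_finite_induct) auto

lemma independent_coeffs_zero:
  assumes "fvec.independent U" "finite U" "\<And>i. (\<Sum>u\<in>U. d u * u i) = 0" "u \<in> U"
  shows "d u = 0"
proof -
  have "(\<Sum>u\<in>U. fscale (d u) u) = 0"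
    using assms(3) by (auto simp: fun_eq_iff sum_fun_apply fscale_def)
  then show ?thesis
    using assms fvec.independentD[of U U d u] by auto
qed

lemma tensor_independent:
  assumes "fvec.independent U" "finite U" "fvec.independent V" "finite V"
    and "fvec.independent W" "finite W"
    and zero: "(\<Sum>u\<in>U. \<Sum>v\<in>V. \<Sum>w\<in>W. fscale (d u v w) (tensor u v w)) = 0"
    and "u \<in> U" "v \<in> V" "w \<in> W"
  shows "d u v w = 0"
proof -
  have z: "(\<Sum>u\<in>U. (\<Sum>v\<in>V. (\<Sum>w\<in>W. d u v w * w k) * v j) * u i) = 0" for i j k
    using fun_cong[OF zero, of "(i, j, k)"]
    by (simp add: sum_fun_apply fscale_def tensor_def sum_distrib_left sum_distrib_right mult_ac)
  have "(\<Sum>v\<in>V. (\<Sum>w\<in>W. d u v w * w k) * v j) = 0" for j k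
    by (rule independent_coeffs_zero[OF assms(1,2) z \<open>u \<in> U\<close>])
  then have "(\<Sum>w\<in>W. d u v w * w k) = 0" for k
    by (rule independent_coeffs_zero[OF assms(3,4) _ \<open>v \<in> V\<close>])
  then show ?thesis
    by (rule independent_coeffs_zero[OF assms(5,6) _ \<open>w \<in> W\<close>])
qed

text \<open>The set minimised over in \<^const>\<open>tensor_rank\<close> is nonempty.\<close>

lemma tensor_rank_attained:
  assumes A: "fvec.subspace A" and T: "T \<in> tensor_space A B C"
  shows "\<exists>a b c. (\<forall>s<tensor_rank A B C T. a s \<in> A \<and> b s \<in> B \<and> c s \<in> C) \<and>
                 T = (\<Sum>s<tensor_rank A B C T. tensor (a s) (b s) (c s))"
proof -
  let ?P = "\<lambda>T (r::nat). \<exists>a b c. (\<forall>s<r. a s \<in> A \<and> b s \<in> B \<and> c s \<in> C) \<and>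
                 T = (\<Sum>s<r. tensor (a s) (b s) (c s))"
  have "\<exists>r. ?P T r"
    using T unfolding tensor_space_def
  proof (induction rule: fvec.span_induct_alt)
    case base
    show ?case by (intro exI[of _ "0::nat"]) auto
  next
    case (step x t y)
    then obtain u v w where t: "t = tensor u v w" "u \<in> A" "v \<in> B" "w \<in> C" by auto
    from step(2) obtain r :: nat and a b c where r: "\<forall>s<r. a s \<in> A \<and> b s \<in> B \<and> c s \<in> C"
      "y = (\<Sum>s<r. tensor (a s) (b s) (c s))" by blast
    have "fscale x t = tensor (fscale x u) v w"
      by (auto simp: t fscale_def tensor_def fun_eq_iff)
    moreover have "fscale x u \<in> A" using A t by (auto simp: fvec.subspace_scale)
    ultimately have "?P (fscale x t + y) (Suc r)"
      using r t by (intro exI[of _ "a(r := fscale x u)"] exI[of _ "b(r := v)"] exI[of _ "c(r := w)"])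
        (auto simp: add.commute less_Suc_eq)
    then show ?case by blast
  qed
  then show ?thesis
    unfolding tensor_rank_def by (rule LeastI_ex)
qed

end

theory Submission
  imports Defs "HOL-Analysis.Analysis"
begin

text \<open>
  A pair \<open>(m, m\<^sup>T)\<close> of an \<open>n \<times> n\<close> matrix and its transpose lies in the span of the
  \<open>n\<^sup>2 + 2 n\<close> matrices \<open>(e\<^sub>j + f\<^sub>k) \<otimes> (e'\<^sub>k + f'\<^sub>j)\<close>, \<open>e\<^sub>j \<otimes> f'\<^sub>j\<close>, \<open>f\<^sub>k \<otimes> e'\<^sub>k\<close> of rank one.
  Take generic \<open>a\<close>-tuples \<open>u\<close>, \<open>u'\<close> of matrices, so that by a dimension count neither tuple lies
  in the span of the other and \<open>r\<close> matrices of rank one. If the tensor with slices \<open>u\<close> is considered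
  modulo the span of \<open>u'\<close>, and the tensor with slices the transpose of \<open>u'\<close> modulo the span of the
  transpose of \<open>u\<close>, then each has rank greater than \<open>r\<close>, but their direct sum has rank at most
  \<open>n\<^sup>2 + 2 n\<close>, which can be less than \<open>2 r + 2\<close>.

  To replace tensors modulo a space of matrices by actual tensors, one adjoins as further slices
  matrices of rank one whose span \<open>G\<close> contains that space; this increases the rank by the
  dimension of \<open>G\<close>, provided that \<open>G\<close> is of no more help than the given space. For this every
  column is cloned many times, and the rank-one generators of \<open>G\<close> are attached to the lines and
  points of a plane. By counting, some line behaves well with respect to all points on it, and
  retracting to the clones on this line turns the coefficients of the generators of \<open>G\<close> into
  coefficients of the given matrices.
\<close>

section \<open>Generic tuples of matrices\<close>

text \<open>Known in this setting as: the tensor with slices \<open>u\<close> has rank at most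
  \<open>r\<close> modulo the span of \<open>M\<close>. The rank-one matrices \<open>x i\<close>
  times \<open>y i\<close> are shared by all slices \<open>q\<close>.\<close>

definition slices_spanned ::
  "nat \<Rightarrow> nat \<Rightarrow> nat \<Rightarrow> (nat \<Rightarrow> nat \<Rightarrow> nat \<Rightarrow> complex) \<Rightarrow> (nat \<Rightarrow> nat \<Rightarrow> nat \<Rightarrow> complex) \<Rightarrow> bool" where
  "slices_spanned n a r u M \<longleftrightarrow> (\<exists>t x y s. \<forall>q<a. \<forall>j<n. \<forall>k<n.
     u q j k = (\<Sum>i<r. t q i * x i j * y i k) + (\<Sum>p<a. s q p * M p j k))"

section \<open>Differentiability of the parametrization of spanned tuples\<close>

lemma differentiable_vec_lambda:
  fixes f :: "'i::finite \<Rightarrow> 'm::euclidean_space \<Rightarrow> 'e::euclidean_space"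
  assumes "\<And>i. f i differentiable (at x)"
  shows "(\<lambda>x. \<chi> i. f i x) differentiable (at x)"
proof (subst differentiable_componentwise_within, intro ballI)
  fix b :: "'e^'i" assume "b \<in> Basis"
  then obtain i v where b: "b = axis i v" by (auto simp: Basis_vec_def)
  have "(\<lambda>x. (\<chi> i. f i x) \<bullet> b) = (\<lambda>x. f i x \<bullet> v)" by (simp add: b inner_axis)
  then show "(\<lambda>x. (\<chi> i. f i x) \<bullet> b) differentiable (at x)"
    using assms[of i] by (auto simp: differentiable_def intro!: derivative_intros)
qed

lemma differentiable_vec_nth:
  fixes g :: "'z::real_normed_vector \<Rightarrow> 'e::real_normed_vector^'i::finite"
  assumes "g differentiable (at p)"
  shows "(\<lambda>p. g p $ i) differentiable (at p)"
  using assms bounded_linear.has_derivative[OF bounded_linear_vec_nth]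
  unfolding differentiable_def by blast

lemma differentiable_fst: "g differentiable (at p) \<Longrightarrow> (\<lambda>p. fst (g p)) differentiable (at p)"
  unfolding differentiable_def by (blast intro: has_derivative_fst)

lemma differentiable_snd: "g differentiable (at p) \<Longrightarrow> (\<lambda>p. snd (g p)) differentiable (at p)"
  unfolding differentiable_def by (blast intro: has_derivative_snd)

lemma differentiable_Pair:
  "f differentiable (at p) \<Longrightarrow> g differentiable (at p) \<Longrightarrow> (\<lambda>p. (f p, g p)) differentiable (at p)"
  unfolding differentiable_def by (blast intro: has_derivative_Pair)

text \<open>Polynomial parametrization of the tuples spanned modulo a given tuple, which is the last
  component of the argument. Finite index types make source and target Euclidean spaces, so that
  their dimensions can be compared.\<close>

definition low_rank_map ::
  "(complex^('a::finite\<times>'r::finite)) \<times> (complex^('r\<times>'n::finite)) \<times> (complex^('r\<times>'n)) \<times>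
    (complex^('a\<times>'a)) \<times> (complex^('a\<times>'n\<times>'n)) \<Rightarrow> (complex^('a\<times>'n\<times>'n))"
  where "low_rank_map = (\<lambda>p. \<chi> l.
    (\<Sum>i\<in>UNIV. fst p $ (fst l, i) * fst (snd p) $ (i, fst (snd l)) *
      fst (snd (snd p)) $ (i, snd (snd l))) +
    (\<Sum>k\<in>UNIV. fst (snd (snd (snd p))) $ (fst l, k) * snd (snd (snd (snd p))) $ (k, snd l)))"

lemma low_rank_map_differentiable: "low_rank_map differentiable (at p)"
  unfolding low_rank_map_def
  by (intro differentiable_vec_lambda differentiable_add differentiable_sum finite ballI
      differentiable_mult differentiable_vec_nth differentiable_fst differentiable_snd
      differentiable_ident)

text \<open>
  The pairs \<open>(u, u')\<close> failing one of the two conditions form two images of spaces of dimension lower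
  than that of the space of all pairs, hence a null set.
\<close>

lemma generic_not_low_rank:
  assumes "CARD('a::finite) * CARD('r::finite) + 2 * CARD('r) * CARD('n::finite) +
      CARD('a) * CARD('a) < CARD('a) * CARD('n) * CARD('n)"
  shows "\<exists>u u'.
      (\<forall>t x y s. u \<noteq> (low_rank_map (t :: complex^('a\<times>'r), x, y, s, u') :: complex^('a\<times>'n\<times>'n))) \<and>
      (\<forall>t x y s. u' \<noteq> (low_rank_map (t :: complex^('a\<times>'r), x, y, s, u) :: complex^('a\<times>'n\<times>'n)))"
proof (rule ccontr)
  let ?L = "low_rank_map :: (complex^('a\<times>'r)) \<times> (complex^('r\<times>'n)) \<times> (complex^('r\<times>'n)) \<times>
    (complex^('a\<times>'a)) \<times> (complex^('a\<times>'n\<times>'n)) \<Rightarrow> (complex^('a\<times>'n\<times>'n))"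
  let ?s = "\<lambda>p :: (complex^('a\<times>'r)) \<times> (complex^('r\<times>'n)) \<times> (complex^('r\<times>'n)) \<times>
    (complex^('a\<times>'a)) \<times> (complex^('a\<times>'n\<times>'n)). snd (snd (snd (snd p)))"
  assume neg: "\<not> ?thesis"
  have "(u, u') \<in> range (\<lambda>p. (?L p, ?s p)) \<union> range (\<lambda>p. (?s p, ?L p))" for u u'
  proof -
    from neg consider t x y s where "u = ?L (t, x, y, s, u')" | t x y s where "u' = ?L (t, x, y, s, u)"
      by blast
    then show ?thesis
    proof cases
      case (1 t x y s)
      then show ?thesis by (intro UnI1 image_eqI[of _ _ "(t, x, y, s, u')"]) auto
    next
      case (2 t x y s)
      then show ?thesis by (intro UnI2 image_eqI[of _ _ "(t, x, y, s, u)"]) auto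
    qed
  qed
  then have U: "UNIV = range (\<lambda>p. (?L p, ?s p)) \<union> range (\<lambda>p. (?s p, ?L p))" by auto
  have D: "?L differentiable (at p)" "?s differentiable (at p)" for p
    by (intro low_rank_map_differentiable differentiable_snd differentiable_ident)+
  \<comment> \<open>The last component contributes a n^2 to the source, while the target has 2 a
    n^2; cancelling leaves the assumption. Real dimensions double both sides.\<close>
  have dim: "DIM((complex^('a\<times>'r)) \<times> (complex^('r\<times>'n)) \<times> (complex^('r\<times>'n)) \<times>
      (complex^('a\<times>'a)) \<times> (complex^('a\<times>'n\<times>'n)))
    < DIM((complex^('a\<times>'n\<times>'n)) \<times> (complex^('a\<times>'n\<times>'n)))"
    using assms by (simp add: algebra_simps)
  have "negligible (range (\<lambda>p. (?L p, ?s p)))" "negligible (range (\<lambda>p. (?s p, ?L p)))"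
    by (rule negligible_differentiable_image_lowdim[OF dim];
        simp add: differentiable_on_def differentiable_Pair D)+
  then have "negligible (UNIV :: ((complex^('a\<times>'n\<times>'n)) \<times> (complex^('a\<times>'n\<times>'n))) set)"
    unfolding U by (rule negligible_Un)
  then show False using open_not_negligible[OF open_UNIV UNIV_not_empty] by (rule notE[rotated])
qed

section \<open>Transfer from finite index types to natural-number indices\<close>

lemma slices_spanned_imp_low_rank_map:
  fixes w w' :: "complex^('a::finite\<times>'n::finite\<times>'n)"
  assumes a: "bij_betw ha {..<CARD('a)} UNIV" and n: "bij_betw hn {..<CARD('n)} UNIV"
    and r: "bij_betw hr {..<CARD('r::finite)} (UNIV :: 'r set)"
    and "slices_spanned CARD('n) CARD('a) CARD('r)
      (\<lambda>q j k. w $ (ha q, hn j, hn k)) (\<lambda>q j k. w' $ (ha q, hn j, hn k))"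
  shows "\<exists>t x y s. w = low_rank_map (t :: complex^('a\<times>'r), x, y, s, w')"
proof -
  obtain t x y s where *: "\<And>q j k. q < CARD('a) \<Longrightarrow> j < CARD('n) \<Longrightarrow> k < CARD('n) \<Longrightarrow>
     w $ (ha q, hn j, hn k) = (\<Sum>i<CARD('r). t q i * x i j * y i k)
        + (\<Sum>p<CARD('a). s q p * w' $ (ha p, hn j, hn k))"
    using assms(4) unfolding slices_spanned_def by blast
  define ga where "ga = inv_into {..<CARD('a)} ha"
  define gn where "gn = inv_into {..<CARD('n)} hn"
  define gr where "gr = inv_into {..<CARD('r)} hr"
  have ga: "ga q < CARD('a)" "ha (ga q) = q" and ga': "p < CARD('a) \<Longrightarrow> ga (ha p) = p" for p q
    using bij_betw_inv_into[OF a] bij_betw_inv_into_right[OF a] bij_betw_inv_into_left[OF a]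
    by (auto simp: ga_def bij_betw_def)
  have gn: "gn j < CARD('n)" "hn (gn j) = j" for j
    using bij_betw_inv_into[OF n] bij_betw_inv_into_right[OF n] by (auto simp: gn_def bij_betw_def)
  have gr: "p < CARD('r) \<Longrightarrow> gr (hr p) = p" for p
    using bij_betw_inv_into_left[OF r] by (auto simp: gr_def)
  have sum_a: "(\<Sum>p\<in>UNIV. f p) = (\<Sum>p<CARD('a). f (ha p))" for f :: "'a \<Rightarrow> complex"
    using sum.reindex_bij_betw[OF a] by metis
  have sum_r: "(\<Sum>p\<in>UNIV. f p) = (\<Sum>p<CARD('r). f (hr p))" for f :: "'r \<Rightarrow> complex"
    using sum.reindex_bij_betw[OF r] by metis
  have "w = low_rank_map (\<chi> l. t (ga (fst l)) (gr (snd l)), \<chi> l. x (gr (fst l)) (gn (snd l)),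
      \<chi> l. y (gr (fst l)) (gn (snd l)), \<chi> l. s (ga (fst l)) (ga (snd l)), w')"
    unfolding vec_eq_iff
  proof
    fix l :: "'a \<times> 'n \<times> 'n"
    obtain q j k where l: "l = (q, j, k)" by (cases l)
    show "w $ l = low_rank_map (\<chi> l. t (ga (fst l)) (gr (snd l)), \<chi> l. x (gr (fst l)) (gn (snd l)),
      \<chi> l. y (gr (fst l)) (gn (snd l)), \<chi> l. s (ga (fst l)) (ga (snd l)), w') $ l"
      using *[OF ga(1)[of q] gn(1)[of j] gn(1)[of k]]
      by (simp add: l low_rank_map_def sum_a sum_r ga ga' gn gr cong: sum.cong_simp)
  qed
  then show ?thesis by blast
qed

text \<open>The types only carry the three numbers; numeral types supply concrete values at the
  end.\<close>

lemma ex_not_slices_spanned: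
  assumes "CARD('a::finite) * CARD('r::finite) + 2 * CARD('r) * CARD('n::finite) +
      CARD('a) * CARD('a) < CARD('a) * CARD('n) * CARD('n)"
  shows "\<exists>u u'. \<not> slices_spanned CARD('n) CARD('a) CARD('r) u u' \<and>
     \<not> slices_spanned CARD('n) CARD('a) CARD('r) u' u"
proof -
  obtain ha hr hn where h: "bij_betw ha {..<CARD('a)} (UNIV :: 'a set)"
    "bij_betw hn {..<CARD('n)} (UNIV :: 'n set)" "bij_betw hr {..<CARD('r)} (UNIV :: 'r set)"
    using ex_bij_betw_nat_finite[OF finite, of "UNIV :: 'a set"]
      ex_bij_betw_nat_finite[OF finite, of "UNIV :: 'n set"]
      ex_bij_betw_nat_finite[OF finite, of "UNIV :: 'r set"] by (auto simp: atLeast0LessThan)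
  obtain w w' :: "complex^('a\<times>'n\<times>'n)" where
    "\<nexists>t x y s. w = low_rank_map (t :: complex^('a\<times>'r), x, y, s, w')"
    "\<nexists>t x y s. w' = low_rank_map (t :: complex^('a\<times>'r), x, y, s, w)"
    using generic_not_low_rank[OF assms] by blast
  then show ?thesis
    using slices_spanned_imp_low_rank_map[OF h, of w w'] slices_spanned_imp_low_rank_map[OF h, of w' w]
    by blast
qed

section \<open>Cloning columns\<close>

text \<open>Coefficients are indexed by \<open>J\<close> and not by the image, so \<open>w\<close>
  may repeat values; indices with equal vectors keep separate coefficients.\<close>

lemma span_image_coeffs:
  assumes "finite J" "v \<in> fvec.span (w ` J)"
  obtains c where "\<And>s. v s = (\<Sum>i\<in>J. c i * w i s)"
proof -
  let ?S = "{v. \<exists>c. \<forall>s. v s = (\<Sum>i\<in>J. c i * w i s)}"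
  have "fvec.subspace ?S"
  proof (rule fvec.subspaceI)
    show "0 \<in> ?S" by (auto intro!: exI[of _ "\<lambda>_. 0"])
  next
    fix x y assume "x \<in> ?S" "y \<in> ?S"
    then obtain c d where "\<forall>s. x s = (\<Sum>i\<in>J. c i * w i s)" "\<forall>s. y s = (\<Sum>i\<in>J. d i * w i s)" by blast
    then show "x + y \<in> ?S"
      by (auto intro!: exI[of _ "\<lambda>i. c i + d i"] simp: sum.distrib algebra_simps)
  next
    fix b x assume "x \<in> ?S"
    then obtain c where "\<forall>s. x s = (\<Sum>i\<in>J. c i * w i s)" by blast
    then show "fscale b x \<in> ?S"
      by (auto intro!: exI[of _ "\<lambda>i. b * c i"] simp: fscale_def sum_distrib_left algebra_simps)
  qed
  moreover have "w ` J \<subseteq> ?S"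
  proof safe
    fix i assume "i \<in> J"
    then show "\<exists>c. \<forall>s. w i s = (\<Sum>i\<in>J. c i * w i s)"
      using \<open>finite J\<close>
      by (intro exI[of _ "\<lambda>i'. if i' = i then 1 else 0"]) (simp add: if_distrib[of "\<lambda>z. z * _"]
          cong: if_cong)
  qed
  ultimately have "fvec.span (w ` J) \<subseteq> ?S" by (rule fvec.span_minimal[rotated])
  then show ?thesis using assms that by blast
qed

definition unit_vec :: "'i \<Rightarrow> 'i \<Rightarrow> complex" where
  "unit_vec i = (\<lambda>j. if j = i then 1 else 0)"

text \<open>The counted vectors are pairwise distinct, since a repeated vector lies in the span of
  its twin. Each lies outside the span of the others, so they are independent in a space of
  dimension at most \<open>a\<close>.\<close>

lemma card_not_in_span_le:
  fixes w :: "'x \<Rightarrow> nat \<Rightarrow> complex"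
  assumes "finite I" and supp: "\<And>i s. s \<ge> a \<Longrightarrow> w i s = 0"
  shows "card {i\<in>I. w i \<notin> fvec.span (w ` (I - {i}))} \<le> a"
proof -
  let ?B = "{i\<in>I. w i \<notin> fvec.span (w ` (I - {i}))}"
  have inj: "inj_on w ?B"
  proof (rule inj_onI, rule ccontr)
    fix i i' assume *: "i \<in> ?B" "i' \<in> ?B" "w i = w i'" "i \<noteq> i'"
    then have "w i \<in> w ` (I - {i})" by auto
    from fvec.span_base[OF this] show False using * by simp
  qed
  have "fvec.independent (w ` ?B)"
    unfolding fvec.dependent_def
  proof (safe)
    fix i assume i: "i \<in> I" "w i \<notin> fvec.span (w ` (I - {i}))" "w i \<in> fvec.span (w ` ?B - {w i})"
    have "w ` ?B - {w i} \<subseteq> w ` (I - {i})" by blast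
    then show False using i(2,3) fvec.span_mono[of _ "w ` (I - {i})"] by blast
  qed
  moreover have "w ` ?B \<subseteq> fvec.span (unit_vec ` {..<a})"
  proof safe
    fix i
    have "w i = (\<Sum>s<a. fscale (w i s) (unit_vec s))"
      using supp[of _ i] by (auto simp: fun_eq_iff sum_fun_apply fscale_def unit_vec_def if_distrib
          sum.delta cong: if_cong)
    also have "\<dots> \<in> fvec.span (unit_vec ` {..<a})"
      by (intro fvec.span_sum fvec.span_scale fvec.span_base) auto
    finally show "w i \<in> fvec.span (unit_vec ` {..<a})" .
  qed
  ultimately have "card (w ` ?B) \<le> card (unit_vec ` {..<a} :: (nat \<Rightarrow> complex) set)"
    using fvec.independent_span_bound by blast
  also have "\<dots> \<le> a" using card_image_le[of "{..<a}"] by auto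
  finally show ?thesis by (simp add: card_image[OF inj])
qed

section \<open>Lines of given intercept and slope, and their points\<close>

definition line :: "nat \<times> nat \<Rightarrow> nat \<Rightarrow> nat" where
  "line e k = fst e + k * snd e"

text \<open>Subtracting the equations at two different abscissae forces equal slopes and then equal
  intercepts. The computation is done in the integers because subtraction of naturals
  truncates.\<close>

lemma line_eq_unique:
  assumes "line e k = line e' k" "line e k' = line e' k'" "e \<noteq> e'"
  shows "k = k'"
proof (rule ccontr)
  assume ne: "k \<noteq> k'"
  have "int (fst e) + int k * int (snd e) = int (fst e') + int k * int (snd e')"
    "int (fst e) + int k' * int (snd e) = int (fst e') + int k' * int (snd e')"
    using assms by (auto simp: line_def simp flip: of_nat_mult of_nat_add)
  then have "(int k - int k') * (int (snd e) - int (snd e')) = 0" by (simp add: algebra_simps)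
  then have "snd e = snd e'" using ne by simp
  with assms show False by (auto simp: line_def prod_eq_iff)
qed

definition lines :: "nat \<Rightarrow> (nat \<times> nat) set" where
  "lines Q = {..<Q} \<times> {..<Q}"

lemma finite_lines [simp]: "finite (lines Q)" by (simp add: lines_def)

text \<open>The intercept is below Q and the rise at most (n - 1) Q. Hence the points (k, q) to be
  considered number n^2 Q, linear in Q, against Q^2 lines.\<close>

lemma line_less: "e \<in> lines Q \<Longrightarrow> k < n \<Longrightarrow> line e k < n * Q"
proof -
  assume "e \<in> lines Q" and k: "k < n"
  then have e: "fst e < Q" "snd e < Q" by (auto simp: lines_def)
  have "k * snd e \<le> (n - 1) * Q" using e k by (intro mult_le_mono) auto
  then have "line e k < Q + (n - 1) * Q" using e unfolding line_def by linarith
  also have "\<dots> = n * Q" using k by (cases n) auto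
  finally show ?thesis .
qed

text \<open>
  For fixed \<open>t\<close> and \<open>(k, q)\<close> the lines through \<open>(k, q)\<close> violating the condition give linearly
  independent vectors of length \<open>a\<close>, so there are at most \<open>a\<close> of them; the total number of violating
  lines is therefore linear in \<open>Q\<close>, while there are \<open>Q\<^sup>2\<close> lines.
\<close>

lemma ex_line_in_spans:
  fixes lam :: "nat \<Rightarrow> nat \<times> nat \<Rightarrow> nat \<Rightarrow> complex" and mu :: "nat \<Rightarrow> nat \<Rightarrow> nat \<Rightarrow> nat \<Rightarrow> complex"
  assumes Q: "n^2 * a^2 < Q"
  obtains e0 c where "e0 \<in> lines Q"
    and "\<And>t k s. t < a \<Longrightarrow> k < n \<Longrightarrow> s < a \<Longrightarrow> lam t e0 s - mu t k (line e0 k) s =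
      (\<Sum>e\<in>{e\<in>lines Q. e \<noteq> e0 \<and> line e k = line e0 k}. c t k e * (lam t e s - mu t k (line e0 k) s))"
proof -
  \<comment> \<open>In the application \<open>lam t e s\<close> and \<open>mu t k q s\<close> are
    the coefficients of a line and a point generator in slice \<open>s\<close>; their difference is
    what these generators leave in the auxiliary row of \<open>e\<close> at an incident point.
    Setting entries from \<open>a\<close> on to zero makes the dimension bound applicable.\<close>
  define w where "w t k q e = (\<lambda>s. if s < a then lam t e s - mu t k q s else 0)" for t k q e
  define I where "I k q = {e\<in>lines Q. line e k = q}" for k q
  define bad where "bad t k q = {e\<in>I k q. w t k q e \<notin> fvec.span (w t k q ` (I k q - {e}))}" for t k q
  have card_bad: "card (bad t k q) \<le> a" for t k q
    unfolding bad_def by (rule card_not_in_span_le) (auto simp: I_def w_def)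
  define U where "U = (\<Union>(t,k,q)\<in>{..<a}\<times>{..<n}\<times>{..<n*Q}. bad t k q)"
  have "card U \<le> (\<Sum>(t,k,q)\<in>{..<a}\<times>{..<n}\<times>{..<n*Q}. a)"
    unfolding U_def
    by (rule order_trans[OF card_UN_le sum_mono]) (auto simp: card_bad)
  \<comment> \<open>At most \<open>a\<close> bad lines for each of \<open>a\<close> values of t and
    n * n Q points: this is the origin of the bound on Q.\<close>
  also have "\<dots> = (n^2 * a^2) * Q" by (simp add: power2_eq_square)
  also have "\<dots> < Q * Q" using Q by simp
  also have "\<dots> = card (lines Q)" by (simp add: lines_def)
  finally have "card U < card (lines Q)" .
  moreover have "finite U" by (auto simp: U_def bad_def I_def)
  ultimately obtain e0 where e0: "e0 \<in> lines Q" "e0 \<notin> U"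
    by (metis card_mono linorder_not_less subsetI)
  let ?P = "\<lambda>t k c. \<forall>s<a. lam t e0 s - mu t k (line e0 k) s =
      (\<Sum>e\<in>{e\<in>lines Q. e \<noteq> e0 \<and> line e k = line e0 k}. c e * (lam t e s - mu t k (line e0 k) s))"
  have ex: "\<exists>c. ?P t k c" if tk: "t < a" "k < n" for t k
  proof -
    let ?q = "line e0 k"
    have "?q < n * Q" using line_less[OF e0(1) tk(2)] .
    then have "e0 \<notin> bad t k ?q" using e0 tk by (auto simp: U_def)
    moreover have "e0 \<in> I k ?q" using e0 by (auto simp: I_def)
    ultimately have "w t k ?q e0 \<in> fvec.span (w t k ?q ` (I k ?q - {e0}))" by (auto simp: bad_def)
    then obtain c where c: "\<And>s. w t k ?q e0 s = (\<Sum>e\<in>I k ?q - {e0}. c e * w t k ?q e s)"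
      by (rule span_image_coeffs[rotated]) (auto simp: I_def)
    have "I k ?q - {e0} = {e\<in>lines Q. e \<noteq> e0 \<and> line e k = ?q}" by (auto simp: I_def)
    moreover have w: "w t k ?q e s = lam t e s - mu t k ?q s" if "s < a" for e s
      using that by (simp add: w_def)
    ultimately show "\<exists>c. \<forall>s<a. lam t e0 s - mu t k ?q s =
      (\<Sum>e\<in>{e\<in>lines Q. e \<noteq> e0 \<and> line e k = ?q}. c e * (lam t e s - mu t k ?q s))"
    proof (intro exI[of _ c] allI impI)
      fix s assume "s < a"
      then show "lam t e0 s - mu t k ?q s =
          (\<Sum>e\<in>{e\<in>lines Q. e \<noteq> e0 \<and> line e k = ?q}. c e * (lam t e s - mu t k ?q s))"
        using c[of s] \<open>I k ?q - {e0} = _\<close> by (simp add: w)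
    qed
  qed
  show ?thesis
    using someI_ex[OF ex] by (intro that[of e0 "\<lambda>t k. SOME c. ?P t k c"] e0) blast
qed

text \<open>
  Column \<open>k\<close> of a matrix is replaced by its clones \<open>(k, q)\<close>. Beside the original rows \<open>Inl j\<close>, there is
  an auxiliary row \<open>Inr (t, e)\<close> for the matrix \<open>M t\<close> and the line \<open>e\<close>.
\<close>

type_synonym row = "nat + nat \<times> nat \<times> nat"

definition clone :: "nat \<Rightarrow> nat \<Rightarrow> (nat \<Rightarrow> nat \<Rightarrow> complex) \<Rightarrow> row \<Rightarrow> nat \<times> nat \<Rightarrow> complex" where
  "clone n Q m x y = (case x of Inl j \<Rightarrow> if j < n \<and> fst y < n \<and> snd y < n * Q then m j (fst y) else 0
    | Inr _ \<Rightarrow> 0)"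

definition line_row :: "nat \<Rightarrow> nat \<times> nat \<Rightarrow> row \<Rightarrow> complex" where
  "line_row t e = unit_vec (Inr (t, e))"

definition line_col :: "nat \<Rightarrow> nat \<times> nat \<Rightarrow> nat \<times> nat \<Rightarrow> complex" where
  "line_col n e y = (if fst y < n \<and> snd y = line e (fst y) then 1 else 0)"

text \<open>In the original rows this is column \<open>k\<close> of \<open>m\<close>; the entries -1
  cancel the line generators of block \<open>t\<close> at the point (k, q).\<close>

definition point_row :: "nat \<Rightarrow> nat \<Rightarrow> (nat \<Rightarrow> nat \<Rightarrow> complex) \<Rightarrow> nat \<Rightarrow> nat \<Rightarrow> nat \<Rightarrow> row \<Rightarrow> complex" where
  "point_row n Q m t k q x = (case x of Inl j \<Rightarrow> if j < n then m j k else 0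
    | Inr (t', e) \<Rightarrow> if t' = t \<and> e \<in> lines Q \<and> line e k = q then - 1 else 0)"

text \<open>In an auxiliary row the ones along a line are removed by the point generators at its
  points; in the original rows only the point generators contribute, giving each clone its column of
  \<open>m\<close>. Any block \<open>t\<close> serves.\<close>

lemma clone_eq_sum:
  "clone n Q m x y = (\<Sum>e\<in>lines Q. line_row t e x * line_col n e y) +
    (\<Sum>k<n. \<Sum>q<n*Q. point_row n Q m t k q x * unit_vec (k, q) y)"
proof -
  obtain k q where y: "y = (k, q)" by (cases y)
  have "(\<Sum>k'<n. \<Sum>q'<n*Q. point_row n Q m t k' q' x * unit_vec (k', q') y) =
    (\<Sum>k'<n. \<Sum>q'<n*Q. if k' = k then if q' = q then point_row n Q m t k q x else 0 else 0)"
    by (intro sum.cong refl) (auto simp: y unit_vec_def)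
  also have "\<dots> = (\<Sum>k'<n. if k' = k then if q < n * Q then point_row n Q m t k q x else 0 else 0)"
    by (intro sum.cong refl) auto
  also have "\<dots> = (if k < n \<and> q < n * Q then point_row n Q m t k q x else 0)"
    by auto
  finally have 1: "(\<Sum>k'<n. \<Sum>q'<n*Q. point_row n Q m t k' q' x * unit_vec (k', q') y) = \<dots>" .
  have 2: "(\<Sum>e\<in>lines Q. line_row t e x * line_col n e y) =
    (case x of Inl _ \<Rightarrow> 0 | Inr (t', e) \<Rightarrow> if t' = t \<and> e \<in> lines Q \<and> k < n \<and> q = line e k then 1 else 0)"
  proof (cases x)
    case (Inr z)
    obtain t' e' where z: "z = (t', e')" by (cases z)
    have "(\<Sum>e\<in>lines Q. line_row t e x * line_col n e y) =
      (\<Sum>e\<in>lines Q. if e = e' then if t' = t \<and> k < n \<and> q = line e' k then 1 else 0 else 0)"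
      by (intro sum.cong refl) (auto simp: Inr z y line_row_def line_col_def unit_vec_def)
    also have "\<dots> = (if t' = t \<and> e' \<in> lines Q \<and> k < n \<and> q = line e' k then 1 else 0)" by auto
    finally show ?thesis by (simp add: Inr z)
  qed (simp add: line_row_def unit_vec_def)
  show ?thesis unfolding 1 2
    by (auto simp: clone_def y point_row_def line_less split: sum.splits)
qed

text \<open>
  A retraction of the extended row space onto the original one; on columns it is combined with the
  selection of the clones \<open>(k, line e0 k)\<close>. It maps matrices of rank one to matrices of rank at most one.
\<close>

definition retract :: "nat \<Rightarrow> nat \<Rightarrow> (nat \<Rightarrow> nat \<times> nat \<Rightarrow> nat \<Rightarrow> complex) \<Rightarrow>
    (row \<Rightarrow> complex) \<Rightarrow> nat \<Rightarrow> complex" where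
  "retract a Q w f j = f (Inl j) + (\<Sum>t<a. \<Sum>e\<in>lines Q. w t e j * f (Inr (t, e)))"

lemma retract_add: "retract a Q w (\<lambda>x. f x + g x) j = retract a Q w f j + retract a Q w g j"
  by (simp add: retract_def sum.distrib algebra_simps)

lemma retract_cmult: "retract a Q w (\<lambda>x. c * f x) j = c * retract a Q w f j"
  by (simp add: retract_def sum_distrib_left algebra_simps)

lemma retract_cmult_right: "retract a Q w (\<lambda>x. f x * c) j = retract a Q w f j * c"
  using retract_cmult[of a Q w c f j] by (simp add: mult.commute)

lemma retract_sum:
  "retract a Q w (\<lambda>x. \<Sum>i\<in>I. f i x) j = (\<Sum>i\<in>I. retract a Q w (f i) j)"
  by (induction I rule: infinite_finite_induct)
    (simp_all add: retract_add, simp_all add: retract_def)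

text \<open>Retract the rows and restrict to the clones lying on a good line \<open>e0\<close>.
  Terms of rank one keep that form, and all generators of block \<open>t\<close> together become one
  multiple of \<open>M t\<close>, with coefficient \<open>lam t e0 s\<close> independent of row and
  column.\<close>

lemma slices_spanned_of_clone:
  assumes Q: "n^2 * a^2 < Q"
    and eq: "\<And>s x y. s < a \<Longrightarrow> clone n Q (u s) x y = (\<Sum>i<r. tt s i * (b i x * c i y)) +
      (\<Sum>t<a. (\<Sum>e\<in>lines Q. lam t e s * (line_row t e x * line_col n e y)) +
         (\<Sum>k<n. \<Sum>q<n*Q. mu t k q s * (point_row n Q (M t) t k q x * unit_vec (k, q) y)))"
  shows "slices_spanned n a r u M"
proof -
  obtain e0 cc where e0: "e0 \<in> lines Q"
    and cc: "\<And>t k s. t < a \<Longrightarrow> k < n \<Longrightarrow> s < a \<Longrightarrow> lam t e0 s - mu t k (line e0 k) s =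
      (\<Sum>e\<in>{e\<in>lines Q. e \<noteq> e0 \<and> line e k = line e0 k}. cc t k e * (lam t e s - mu t k (line e0 k) s))"
    by (rule ex_line_in_spans[OF Q, of lam mu]) (rule that)
  \<comment> \<open>For fixed \<open>t\<close>, \<open>e\<close> and \<open>j\<close> at most one
    summand is nonzero, since a line other than \<open>e0\<close> meets it over at most one
    \<open>k\<close>. The auxiliary row of \<open>e0\<close> itself is sent to zero.\<close>
  define w where "w t e j = (\<Sum>k<n. if e \<noteq> e0 \<and> line e k = line e0 k then cc t k e * M t j k else 0)"
      for t e j
  let ?R = "retract a Q w"
  have w: "w t e j = cc t k e * M t j k" if "e \<noteq> e0" "line e k = line e0 k" "k < n" for t e j k
  proof -
    have "(e \<noteq> e0 \<and> line e k' = line e0 k') = (k' = k)" for k'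
      using that line_eq_unique by blast
    then have "w t e j = (\<Sum>k'<n. if k' = k then cc t k e * M t j k else 0)"
      unfolding w_def by (intro sum.cong refl) auto
    then show ?thesis using that by simp
  qed
  have w0: "w t e0 j = 0" for t j by (simp add: w_def)
  have R_line: "?R (line_row t e) j = w t e j" if "t < a" "e \<in> lines Q" for t e j
  proof -
    have "?R (line_row t e) j = (\<Sum>t'<a. \<Sum>e'\<in>lines Q. if t' = t then if e' = e then w t e j else 0 else 0)"
      by (auto simp: retract_def line_row_def unit_vec_def intro!: sum.cong)
    also have "\<dots> = (\<Sum>t'<a. if t' = t then w t e j else 0)"
      using that by (intro sum.cong refl) auto
    finally show ?thesis using that by simp
  qed
  have R_point: "?R (point_row n Q m t k q) j = m j k - (\<Sum>e\<in>{e\<in>lines Q. line e k = q}. w t e j)"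
    if "t < a" "j < n" for t k q j m
  proof -
    have "(\<Sum>t'<a. \<Sum>e\<in>lines Q. w t' e j * point_row n Q m t k q (Inr (t', e))) =
      (\<Sum>t'<a. if t' = t then - (\<Sum>e\<in>lines Q. if line e k = q then w t e j else 0) else 0)"
      by (intro sum.cong refl) (auto simp: point_row_def simp flip: sum_negf intro!: sum.cong)
    also have "\<dots> = - (\<Sum>e\<in>{e\<in>lines Q. line e k = q}. w t e j)"
      using that by (simp add: sum.inter_filter)
    finally show ?thesis using that by (simp add: retract_def point_row_def)
  qed
  have key: "u s j k = (\<Sum>i<r. tt s i * (?R (b i) j * c i (k, line e0 k))) + (\<Sum>t<a. lam t e0 s * M t j k)"
    if s: "s < a" and j: "j < n" and k: "k < n" for s j k
  proof -
    let ?y = "(k, line e0 k)"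
    let ?L = "{e\<in>lines Q. e \<noteq> e0 \<and> line e k = line e0 k}"
    have less: "line e0 k < n * Q" using line_less[OF e0 k] .
    \<comment> \<open>A clone vanishes on the auxiliary rows, so the retraction returns the original
      entry.\<close>
    have "u s j k = ?R (\<lambda>x. clone n Q (u s) x ?y) j"
      using j k less by (simp add: retract_def clone_def)
    also have "\<dots> = (\<Sum>i<r. tt s i * (?R (b i) j * c i ?y)) +
      (\<Sum>t<a. (\<Sum>e\<in>lines Q. lam t e s * (?R (line_row t e) j * line_col n e ?y)) +
         (\<Sum>k'<n. \<Sum>q<n*Q. mu t k' q s * (?R (point_row n Q (M t) t k' q) j * unit_vec (k', q) ?y)))"
      unfolding eq[OF s]
      by (simp only: retract_add retract_sum retract_cmult retract_cmult_right)
    also have "(\<Sum>t<a. (\<Sum>e\<in>lines Q. lam t e s * (?R (line_row t e) j * line_col n e ?y)) +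
         (\<Sum>k'<n. \<Sum>q<n*Q. mu t k' q s * (?R (point_row n Q (M t) t k' q) j * unit_vec (k', q) ?y)))
      = (\<Sum>t<a. lam t e0 s * M t j k)"
    proof (rule sum.cong[OF refl])
      fix t assume "t \<in> {..<a}"
      then have t: "t < a" by simp
      let ?m = "mu t k (line e0 k) s"
      \<comment> \<open>Only the lines through the point (k, line e0 k) have an entry in this
        column, and \<open>e0\<close> is retracted to zero.\<close>
      have "(\<Sum>e\<in>lines Q. lam t e s * (?R (line_row t e) j * line_col n e ?y)) =
        (\<Sum>e\<in>lines Q. if e \<noteq> e0 \<and> line e k = line e0 k then lam t e s * (cc t k e * M t j k) else 0)"
        using k w0 by (intro sum.cong refl) (auto simp: R_line[OF t] line_col_def w)
      also have "\<dots> = (\<Sum>e\<in>?L. lam t e s * (cc t k e * M t j k))"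
        by (simp add: sum.inter_filter)
      finally have 1: "(\<Sum>e\<in>lines Q. lam t e s * (?R (line_row t e) j * line_col n e ?y)) = \<dots>" .
      have "(\<Sum>k'<n. \<Sum>q<n*Q. mu t k' q s * (?R (point_row n Q (M t) t k' q) j * unit_vec (k', q) ?y))
        = (\<Sum>k'<n. \<Sum>q<n*Q. if k' = k then if q = line e0 k
            then ?m * ?R (point_row n Q (M t) t k (line e0 k)) j else 0 else 0)"
        by (intro sum.cong refl) (auto simp: unit_vec_def)
      also have "\<dots> = (\<Sum>k'<n. if k' = k then ?m * ?R (point_row n Q (M t) t k (line e0 k)) j else 0)"
        using less by (intro sum.cong refl) auto
      also have "\<dots> = ?m * ?R (point_row n Q (M t) t k (line e0 k)) j" using k by simp
      also have "?R (point_row n Q (M t) t k (line e0 k)) j = M t j k - (\<Sum>e\<in>?L. cc t k e * M t j k)"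
      proof -
        have "(\<Sum>e\<in>{e\<in>lines Q. line e k = line e0 k}. w t e j) = (\<Sum>e\<in>?L. w t e j)"
          using w0[of t j] by (intro sum.mono_neutral_right) auto
        also have "\<dots> = (\<Sum>e\<in>?L. cc t k e * M t j k)"
          using k by (intro sum.cong refl) (auto simp: w)
        finally show ?thesis by (simp add: R_point[OF t j])
      qed
      finally have 2: "(\<Sum>k'<n. \<Sum>q<n*Q. mu t k' q s *
          (?R (point_row n Q (M t) t k' q) j * unit_vec (k', q) ?y))
         = ?m * (M t j k - (\<Sum>e\<in>?L. cc t k e * M t j k))" .
      \<comment> \<open>The defining relation of \<open>cc\<close> replaces the sum over the other
        lines by \<open>lam t e0 s - ?m\<close>. The point coefficient cancels, and with it the
        dependence on \<open>k\<close>.\<close>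
      have "(\<Sum>e\<in>?L. lam t e s * (cc t k e * M t j k)) + ?m * (M t j k - (\<Sum>e\<in>?L. cc t k e * M t j k))
        = (?m + (\<Sum>e\<in>?L. cc t k e * (lam t e s - ?m))) * M t j k"
        by (simp add: algebra_simps sum_distrib_left sum_distrib_right sum_subtractf)
      also have "\<dots> = lam t e0 s * M t j k" by (simp flip: cc[OF t k s])
      finally show "(\<Sum>e\<in>lines Q. lam t e s * (?R (line_row t e) j * line_col n e ?y)) +
         (\<Sum>k'<n. \<Sum>q<n*Q. mu t k' q s * (?R (point_row n Q (M t) t k' q) j * unit_vec (k', q) ?y))
        = lam t e0 s * M t j k" unfolding 1 2 .
    qed
    finally show ?thesis .
  qed
  show ?thesis
    unfolding slices_spanned_def
    using key by (intro exI[of _ tt] exI[of _ "\<lambda>i. ?R (b i)"] exI[of _ "\<lambda>i k. c i (k, line e0 k)"]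
       exI[of _ "\<lambda>s t. lam t e0 s"]) (simp add: mult.assoc)
qed

section \<open>Rank-one generators in natural-number coordinates\<close>

definition outer :: "('i \<Rightarrow> complex) \<Rightarrow> ('j \<Rightarrow> complex) \<Rightarrow> 'i \<times> 'j \<Rightarrow> complex" where
  "outer x y = (\<lambda>(i, j). x i * y j)"

definition embed_matrix :: "nat \<Rightarrow> (nat \<Rightarrow> 'i \<Rightarrow> complex) \<Rightarrow> (nat \<Rightarrow> 'j \<Rightarrow> complex) \<Rightarrow>
    (nat \<Rightarrow> nat \<Rightarrow> complex) \<Rightarrow> 'i \<times> 'j \<Rightarrow> complex" where
  "embed_matrix n e f m = (\<Sum>j<n. \<Sum>k<n. fscale (m j k) (outer (e j) (f k)))"

text \<open>The cloned matrix is the image of the original under e_j and f_k, where f_k is the sum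
  of all clones of column k. The generators attached to lines and points form \<open>G\<close>;
  cloning makes them of no more help than \<open>M\<close>.\<close>

lemma ex_clone_space:
  fixes M :: "nat \<Rightarrow> nat \<Rightarrow> nat \<Rightarrow> complex"
  shows "\<exists>(e :: nat \<Rightarrow> nat \<Rightarrow> complex) (f :: nat \<Rightarrow> nat \<Rightarrow> complex) G.
    finite G \<and> (\<forall>g\<in>G. \<exists>x y. g = outer x y) \<and>
    (\<forall>t<a. embed_matrix n e f (M t) \<in> fvec.span G) \<and>
    (\<forall>u r b c.
      (\<forall>s<a. embed_matrix n e f (u s) \<in> fvec.span (G \<union> (\<lambda>i. outer (b i) (c i)) ` {..<r}))
      \<longrightarrow> slices_spanned n a r u M)"
proof -
  define Q where "Q = Suc (n^2 * a^2)"
  have Q: "n^2 * a^2 < Q" by (simp add: Q_def)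
  \<comment> \<open>Functions on rows and clones are pulled back along \<open>from_nat\<close>;
    evaluation at \<open>to_nat\<close> recovers them.\<close>
  define e :: "nat \<Rightarrow> nat \<Rightarrow> complex" where "e j i = unit_vec (Inl j) (from_nat i :: row)" for j i
  define f :: "nat \<Rightarrow> nat \<Rightarrow> complex" where
    "f k i = (let y = from_nat i in if fst y = k \<and> snd y < n * Q then 1 else 0)" for k i
  define gl :: "nat \<times> nat \<times> nat \<Rightarrow> nat \<times> nat \<Rightarrow> complex" where
    "gl = (\<lambda>(t, d). outer (\<lambda>i. line_row t d (from_nat i)) (\<lambda>i. line_col n d (from_nat i)))"
  define gp :: "nat \<times> nat \<times> nat \<Rightarrow> nat \<times> nat \<Rightarrow> complex" where
    "gp = (\<lambda>(t, k, q).
      outer (\<lambda>i. point_row n Q (M t) t k q (from_nat i)) (\<lambda>i. unit_vec (k, q) (from_nat i)))"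
  define J where "J = ({..<a} \<times> lines Q) <+> ({..<a} \<times> {..<n} \<times> {..<n * Q})"
  define G where "G = case_sum gl gp ` J"
  have embed: "embed_matrix n e f m (i, j) = clone n Q m (from_nat i) (from_nat j)" for m i j
  proof -
    obtain k q :: nat where y: "from_nat j = (k, q)" by (cases "from_nat j :: nat \<times> nat")
    have "embed_matrix n e f m (i, j) = (\<Sum>j'<n. \<Sum>k'<n. m j' k' * (e j' i * f k' j))"
      by (simp add: embed_matrix_def sum_fun_apply fscale_def outer_def)
    also have "\<dots> = (\<Sum>j'<n. e j' i * (\<Sum>k'<n. if k' = k then if q < n * Q then m j' k else 0 else 0))"
      unfolding sum_distrib_left by (intro sum.cong refl) (auto simp: f_def y)
    also have "\<dots> = (\<Sum>j'<n. e j' i * (if k < n \<and> q < n * Q then m j' k else 0))"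
      by (intro sum.cong refl) auto
    also have "\<dots> = clone n Q m (from_nat i) (k, q)"
    proof (cases "from_nat i :: row")
      case (Inl j0)
      have "(\<Sum>j'<n. e j' i * (if k < n \<and> q < n * Q then m j' k else 0)) =
         (\<Sum>j'<n. if j' = j0 then if k < n \<and> q < n * Q then m j0 k else 0 else 0)"
        by (intro sum.cong refl) (auto simp: e_def Inl unit_vec_def)
      then show ?thesis by (auto simp: clone_def Inl)
    qed (simp add: e_def clone_def unit_vec_def)
    finally show ?thesis by (simp add: y)
  qed
  show ?thesis
  proof (rule exI[of _ e], rule exI[of _ f], rule exI[of _ G], intro conjI allI ballI impI)
    show "finite G" by (simp add: G_def J_def)
    have "\<exists>x y. gl z = outer x y" "\<exists>x y. gp z = outer x y" for z
      unfolding gl_def gp_def case_prod_beta by (rule exI, rule exI, rule refl)+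
    then show "\<exists>x y. g = outer x y" if "g \<in> G" for g
      using that by (auto simp: G_def J_def)
    show "embed_matrix n e f (M t) \<in> fvec.span G" if "t < a" for t
    proof -
      have "embed_matrix n e f (M t) = (\<Sum>d\<in>lines Q. gl (t, d)) + (\<Sum>k<n. \<Sum>q<n*Q. gp (t, k, q))"
        by (auto simp: fun_eq_iff embed clone_eq_sum[of _ _ _ _ _ t] sum_fun_apply gl_def gp_def outer_def)
      also have "\<dots> \<in> fvec.span G"
        using that by (intro fvec.span_add fvec.span_sum fvec.span_base) (force simp: G_def J_def
            image_iff)+
      finally show ?thesis .
    qed
    fix u :: "nat \<Rightarrow> nat \<Rightarrow> nat \<Rightarrow> complex" and r :: nat and b c :: "nat \<Rightarrow> nat \<Rightarrow> complex"
    assume sp: "\<forall>s<a. embed_matrix n e f (u s) \<in> fvec.span (G \<union> (\<lambda>i. outer (b i) (c i)) ` {..<r})"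
    \<comment> \<open>Indexing by a disjoint sum keeps the coefficients of line generators, point
      generators and the \<open>r\<close> further matrices apart even when some of these
      coincide.\<close>
    let ?w = "case_sum (case_sum gl gp) (\<lambda>i. outer (b i) (c i))"
    have G_Un: "G \<union> (\<lambda>i. outer (b i) (c i)) ` {..<r} = ?w ` (J <+> {..<r})"
      by (simp add: G_def Plus_def image_Un image_image)
    let ?P = "\<lambda>s d. \<forall>p. embed_matrix n e f (u s) p = (\<Sum>i\<in>J <+> {..<r}. d i * ?w i p)"
    have ex: "\<exists>d. ?P s d" if "s < a" for s
      using sp[rule_format, OF that] unfolding G_Un
      by (rule span_image_coeffs[rotated]) (auto simp: J_def)
    define d where "d s = (SOME d. ?P s d)" for s
    have d: "embed_matrix n e f (u s) p = (\<Sum>i\<in>J <+> {..<r}. d s i * ?w i p)" if "s < a" for s p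
      using someI_ex[OF ex[OF that]] unfolding d_def by (rule spec)
    show "slices_spanned n a r u M"
    proof (rule slices_spanned_of_clone[OF Q])
      fix s x y assume s: "s < a"
      have J: "finite J" by (simp add: J_def)
      have "clone n Q (u s) x y = embed_matrix n e f (u s) (to_nat x, to_nat y)" by (simp add: embed)
      also have "\<dots> = (\<Sum>i<r. d s (Inr i) * (b i (to_nat x) * c i (to_nat y))) +
         (\<Sum>i\<in>J. d s (Inl i) * case_sum gl gp i (to_nat x, to_nat y))"
        unfolding d[OF s] by (simp add: sum.Plus J outer_def)
      also have "(\<Sum>i\<in>J. d s (Inl i) * case_sum gl gp i (to_nat x, to_nat y)) =
        (\<Sum>t<a. (\<Sum>e\<in>lines Q. d s (Inl (Inl (t, e))) * (line_row t e x * line_col n e y)) +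
         (\<Sum>k<n. \<Sum>q<n*Q. d s (Inl (Inr (t, k, q))) * (point_row n Q (M t) t k q x * unit_vec (k, q) y)))"
        unfolding J_def
        by (simp add: sum.Plus sum.distrib gl_def gp_def outer_def sum.cartesian_product split_def)
      finally show "clone n Q (u s) x y = (\<Sum>i<r. d s (Inr i) * (b i (to_nat x) * c i (to_nat y))) + \<dots>" .
    qed
  qed
qed

section \<open>Tensors with slices of rank one\<close>

definition slab :: "('i \<Rightarrow> complex) \<Rightarrow> ('j \<times> 'k \<Rightarrow> complex) \<Rightarrow> 'i \<times> 'j \<times> 'k \<Rightarrow> complex" where
  "slab a m = (\<lambda>(i, p). a i * m p)"

lemma span_sum_coeffs:
  assumes "finite P" "m \<in> fvec.span P"
  obtains d where "\<And>x. m x = (\<Sum>p\<in>P. d p * p x)"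
  using span_image_coeffs[OF assms(1), of m "\<lambda>p. p"] assms(2) by auto

lemma fd_space_span: "finite S \<Longrightarrow> fd_space (fvec.span S)"
  by (auto simp: fd_space_def)

text \<open>Expand each \<open>m i\<close> in the rank-one matrices of \<open>P\<close> and exchange
  the sums: \<open>p\<close> is then paired with the combination \<open>x p\<close> of the vectors
  \<open>a i\<close>. The number of terms is that of \<open>P\<close>, whatever \<open>I\<close>
  is.\<close>

lemma sum_slab_eq_sum_tensor:
  assumes A: "fvec.subspace A" and "finite P" and P: "\<And>p. p \<in> P \<Longrightarrow> \<exists>b\<in>B. \<exists>c\<in>C. p = outer b c"
    and m: "\<And>i. i \<in> I \<Longrightarrow> a i \<in> A \<and> m i \<in> fvec.span P"
  shows "\<exists>x b c. (\<forall>p\<in>P. x p \<in> A \<and> b p \<in> B \<and> c p \<in> C) \<and>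
    (\<Sum>i\<in>I. slab (a i) (m i)) = (\<Sum>p\<in>P. tensor (x p) (b p) (c p))"
proof -
  have "\<forall>p\<in>P. \<exists>z. fst z \<in> B \<and> snd z \<in> C \<and> p = outer (fst z) (snd z)"
    using P by fastforce
  from bchoice[OF this] obtain z where
    z: "\<And>p. p \<in> P \<Longrightarrow> fst (z p) \<in> B \<and> snd (z p) \<in> C \<and> p = outer (fst (z p)) (snd (z p))" by blast
  define b where "b p = fst (z p)" for p
  define c where "c p = snd (z p)" for p
  have bc: "b p \<in> B" "c p \<in> C" "p = outer (b p) (c p)" if "p \<in> P" for p
    using z[OF that] by (auto simp: b_def c_def)
  define d where "d i = (SOME d. \<forall>x. m i x = (\<Sum>p\<in>P. d p * p x))" for i
  have d: "m i x = (\<Sum>p\<in>P. d i p * p x)" if "i \<in> I" for i x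
  proof -
    have "m i \<in> fvec.span P" using m[OF that] by simp
    then obtain d' where "\<And>x. m i x = (\<Sum>p\<in>P. d' p * p x)"
      using span_sum_coeffs[OF \<open>finite P\<close>] by blast
    then have "\<exists>d. \<forall>x. m i x = (\<Sum>p\<in>P. d p * p x)" by blast
    from someI_ex[OF this] show ?thesis unfolding d_def by blast
  qed
  define x where "x p = (\<Sum>i\<in>I. fscale (d i p) (a i))" for p
  have outer: "p (j, k) = b p j * c p k" if "p \<in> P" for p j k
    using fun_cong[OF bc(3)[OF that], of "(j, k)"] by (simp add: outer_def)
  show ?thesis
  proof (intro exI conjI)
    show "\<forall>p\<in>P. x p \<in> A \<and> b p \<in> B \<and> c p \<in> C"
      using bc A m unfolding x_def
      by (auto intro!: fvec.subspace_sum fvec.subspace_scale)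
    show "(\<Sum>i\<in>I. slab (a i) (m i)) = (\<Sum>p\<in>P. tensor (x p) (b p) (c p))"
    proof
      fix z :: "'a \<times> 'b \<times> 'c"
      obtain i j k where z: "z = (i, j, k)" by (cases z)
      have "(\<Sum>i\<in>I. slab (a i) (m i)) z = (\<Sum>i'\<in>I. \<Sum>p\<in>P. a i' i * (d i' p * (b p j * c p k)))"
        by (simp add: z sum_fun_apply slab_def d outer sum_distrib_left)
      also have "\<dots> = (\<Sum>p\<in>P. \<Sum>i'\<in>I. a i' i * (d i' p * (b p j * c p k)))" by (rule sum.swap)
      also have "\<dots> = (\<Sum>p\<in>P. tensor (x p) (b p) (c p)) z"
        by (simp add: z sum_fun_apply tensor_def x_def fscale_def sum_distrib_left sum_distrib_right
            mult_ac)
      finally show "(\<Sum>i\<in>I. slab (a i) (m i)) z = (\<Sum>p\<in>P. tensor (x p) (b p) (c p)) z" .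
    qed
  qed
qed

lemma tensor_rank_sum_slab_le:
  assumes "fvec.subspace A" "finite P" "\<And>p. p \<in> P \<Longrightarrow> \<exists>b\<in>B. \<exists>c\<in>C. p = outer b c"
    and "\<And>i. i \<in> I \<Longrightarrow> a i \<in> A \<and> m i \<in> fvec.span P"
  shows "tensor_rank A B C (\<Sum>i\<in>I. slab (a i) (m i)) \<le> card P"
proof -
  obtain x b c where
    x: "\<And>p. p \<in> P \<Longrightarrow> x p \<in> A \<and> b p \<in> B \<and> c p \<in> C"
    and eq: "(\<Sum>i\<in>I. slab (a i) (m i)) = (\<Sum>p\<in>P. tensor (x p) (b p) (c p))"
    using sum_slab_eq_sum_tensor[of A P B C I a m, OF assms] by blast
  obtain h where h: "bij_betw h {..<card P} P"
    using ex_bij_betw_nat_finite[OF \<open>finite P\<close>] by (auto simp: atLeast0LessThan)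
  then have hP: "h s \<in> P" if "s < card P" for s using that by (auto simp: bij_betw_def)
  show ?thesis unfolding tensor_rank_def
  proof (rule Least_le, intro exI conjI allI impI)
    show "(\<Sum>i\<in>I. slab (a i) (m i)) = (\<Sum>s<card P. tensor ((x \<circ> h) s) ((b \<circ> h) s) ((c \<circ> h) s))"
      using sum.reindex_bij_betw[OF h, of "\<lambda>p. tensor (x p) (b p) (c p)"] by (simp add: eq)
  qed (use x[OF hP] in auto)
qed

lemma sum_slab_in_tensor_space:
  assumes "fvec.subspace A" "finite P" "\<And>p. p \<in> P \<Longrightarrow> \<exists>b\<in>B. \<exists>c\<in>C. p = outer b c"
    and "\<And>i. i \<in> I \<Longrightarrow> a i \<in> A \<and> m i \<in> fvec.span P"
  shows "(\<Sum>i\<in>I. slab (a i) (m i)) \<in> tensor_space A B C"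
proof -
  obtain x b c where
    x: "\<And>p. p \<in> P \<Longrightarrow> x p \<in> A \<and> b p \<in> B \<and> c p \<in> C"
    and eq: "(\<Sum>i\<in>I. slab (a i) (m i)) = (\<Sum>p\<in>P. tensor (x p) (b p) (c p))"
    using sum_slab_eq_sum_tensor[of A P B C I a m, OF assms] by blast
  show ?thesis unfolding eq tensor_space_def
    by (intro fvec.span_sum fvec.span_base) (use x in blast)
qed

text \<open>Fixing the first coordinate \<open>i\<close> in an optimal decomposition leaves a
  combination of its matrices with coefficients \<open>a s i\<close>.\<close>

lemma slices_in_span_of_tensor_rank:
  assumes "fvec.subspace A" "T \<in> tensor_space A B C"
  shows "\<exists>b c. \<forall>i. (\<lambda>p. T (i, p)) \<in> fvec.span ((\<lambda>s. outer (b s) (c s)) ` {..<tensor_rank A B C T})"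
proof -
  let ?R = "tensor_rank A B C T"
  obtain a b c where T: "T = (\<Sum>s<?R. tensor (a s) (b s) (c s))"
    using tensor_rank_attained[OF assms] by blast
  have "(\<lambda>p. T (i, p)) \<in> fvec.span ((\<lambda>s. outer (b s) (c s)) ` {..<?R})" for i
  proof -
    have "(\<lambda>p. (\<Sum>s<?R. tensor (a s) (b s) (c s)) (i, p)) = (\<Sum>s<?R. fscale (a s i) (outer (b s) (c s)))"
      by (auto simp: fun_eq_iff sum_fun_apply tensor_def fscale_def outer_def mult.assoc)
    also have "\<dots> \<in> fvec.span ((\<lambda>s. outer (b s) (c s)) ` {..<?R})"
      by (intro fvec.span_sum fvec.span_scale fvec.span_base) auto
    finally show ?thesis by (simp flip: T)
  qed
  then show ?thesis by blast
qed

text \<open>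
  In a decomposition of \<open>T\<close>, the slices in \<open>H\<close> extend by some of its rank-one matrices to a basis of
  their span.
\<close>

lemma substitution_lower_bound:
  assumes A: "fvec.subspace A" and T: "T \<in> tensor_space A B C"
    and H: "fvec.independent H" and slice: "\<And>g. g \<in> H \<Longrightarrow> \<exists>i. g = (\<lambda>p. T (i, p))"
    and gen: "\<And>b c. \<exists>i. (\<lambda>p. T (i, p)) \<notin> fvec.span (H \<union> (\<lambda>s. outer (b s) (c s)) ` {..<r})"
  shows "card H + r < tensor_rank A B C T"
proof (rule ccontr)
  let ?R = "tensor_rank A B C T"
  assume "\<not> ?thesis"
  then have R: "?R \<le> card H + r" by simp
  obtain b c where bc: "\<And>i. (\<lambda>p. T (i, p)) \<in> fvec.span ((\<lambda>s. outer (b s) (c s)) ` {..<?R})"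
    using slices_in_span_of_tensor_rank[OF A T] by blast
  let ?P = "(\<lambda>s. outer (b s) (c s)) ` {..<?R}"
  have "H \<subseteq> fvec.span ?P" using slice bc by blast
  then have HP: "H \<union> ?P \<subseteq> fvec.span ?P" using fvec.span_superset[of ?P] by blast
  obtain t where t: "H \<subseteq> t" "t \<subseteq> H \<union> ?P" "fvec.independent t" "H \<union> ?P \<subseteq> fvec.span t"
    using fvec.maximal_independent_subset_extend[OF _ H, of "H \<union> ?P"] by blast
  have cardt: "finite t" "card t \<le> card ?P"
    using fvec.independent_span_bound[OF _ t(3), of ?P] t(2) HP by auto
  have spant: "fvec.span ?P \<subseteq> fvec.span t"
    using t(4) by (intro fvec.span_minimal) auto
  have "card ?P \<le> ?R" using card_image_le[of "{..<?R}"] by auto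
  then have card: "card (t - H) \<le> r" using t(1) cardt R
      by (simp add: card_Diff_subset finite_subset[OF t(1)])
  obtain h where h: "bij_betw h {..<card (t - H)} (t - H)"
    using ex_bij_betw_nat_finite[of "t - H"] cardt by (auto simp: atLeast0LessThan)
  \<comment> \<open>The at most \<open>r\<close> basis elements outside \<open>H\<close> are written
    as outer products, to be fed to \<open>gen\<close>. Values of \<open>h\<close> past their number
    are arbitrary and can only enlarge the span.\<close>
  define s where "s p = (SOME s. p = outer (b s) (c s))" for p
  have s: "p = outer (b (s p)) (c (s p))" if "p \<in> t - H" for p
    unfolding s_def by (rule someI_ex) (use that t(2) in blast)
  have "t - H \<subseteq> (\<lambda>i. outer (b (s (h i))) (c (s (h i)))) ` {..<r}"
  proof
    fix p assume p: "p \<in> t - H"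
    then have "p \<in> h ` {..<card (t - H)}" using h by (simp add: bij_betw_def)
    then obtain i where "i < card (t - H)" "h i = p" by blast
    then show "p \<in> (\<lambda>i. outer (b (s (h i))) (c (s (h i)))) ` {..<r}"
      using card s[OF p] by (intro image_eqI[of _ _ i]) auto
  qed
  then have "fvec.span t \<subseteq> fvec.span (H \<union> (\<lambda>i. outer (b (s (h i))) (c (s (h i)))) ` {..<r})"
    by (intro fvec.span_mono) blast
  then show False using gen[of "\<lambda>i. b (s (h i))" "\<lambda>i. c (s (h i))"] bc spant by blast
qed

text \<open>Actual tensor standing for \<open>u\<close> modulo the span of \<open>M\<close>. The
  last clause is the lower bound on its rank; the explicit slices and the rank-one elements of
  \<open>H\<close> serve the upper bound for the direct sum.\<close>

definition gap_tensor ::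
  "nat \<Rightarrow> nat \<Rightarrow> nat \<Rightarrow> (nat \<Rightarrow> nat \<Rightarrow> nat \<Rightarrow> complex) \<Rightarrow> (nat \<Rightarrow> nat \<Rightarrow> nat \<Rightarrow> complex) \<Rightarrow>
    (nat \<Rightarrow> complex) set \<Rightarrow> (nat \<Rightarrow> complex) set \<Rightarrow> (nat \<Rightarrow> complex) set \<Rightarrow>
    nat \<Rightarrow> (nat \<Rightarrow> nat \<Rightarrow> complex) \<Rightarrow> (nat \<Rightarrow> nat \<times> nat \<Rightarrow> complex) \<Rightarrow>
    (nat \<Rightarrow> nat \<Rightarrow> complex) \<Rightarrow> (nat \<Rightarrow> nat \<Rightarrow> complex) \<Rightarrow> (nat \<times> nat \<Rightarrow> complex) set \<Rightarrow> bool" where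
  "gap_tensor n a r u M A B C N x m e f H \<longleftrightarrow>
    fd_space A \<and> fd_space B \<and> fd_space C \<and> (\<forall>s<N. x s \<in> A) \<and> (\<forall>j<n. e j \<in> B) \<and> (\<forall>k<n. f k \<in> C) \<and>
    finite H \<and> (\<forall>p\<in>H. \<exists>b\<in>B. \<exists>c\<in>C. p = outer b c) \<and>
    (\<forall>s<N. m s \<in> H \<or> (\<exists>q<a. m s = embed_matrix n e f (u q))) \<and>
    (\<forall>q<a. embed_matrix n e f (M q) \<in> fvec.span H) \<and>
    (\<Sum>s<N. slab (x s) (m s)) \<in> tensor_space A B C \<and>
    card H + r < tensor_rank A B C (\<Sum>s<N. slab (x s) (m s))"

lemma gap_tensorD:
  assumes "gap_tensor n a r u M A B C N x m e f H"
  shows "fd_space A"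
    "fd_space B"
    "fd_space C"
    "\<forall>s<N. x s \<in> A"
    "\<forall>j<n. e j \<in> B"
    "\<forall>k<n. f k \<in> C"
    "finite H"
    "\<forall>p\<in>H. \<exists>b\<in>B. \<exists>c\<in>C. p = outer b c"
    "\<forall>s<N. m s \<in> H \<or> (\<exists>q<a. m s = embed_matrix n e f (u q))"
    "\<forall>q<a. embed_matrix n e f (M q) \<in> fvec.span H"
    "(\<Sum>s<N. slab (x s) (m s)) \<in> tensor_space A B C"
    "card H + r < tensor_rank A B C (\<Sum>s<N. slab (x s) (m s))"
  using assms unfolding gap_tensor_def by blast+

text \<open>A maximal independent subset \<open>H\<close> of the generators has the span of
  \<open>G\<close>, hence helps no more than \<open>M\<close>. Adjoining it as slices and applying
  \<open>substitution_lower_bound\<close> gives the gap.\<close>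

lemma ex_gap_tensor:
  assumes "\<not> slices_spanned n a r u M"
  shows "\<exists>A B C N x m e f H. gap_tensor n a r u M A B C N x m e f H"
proof -
  obtain e f :: "nat \<Rightarrow> nat \<Rightarrow> complex" and G where G: "finite G" "\<forall>g\<in>G. \<exists>x y. g = outer x y"
    "\<forall>t<a. embed_matrix n e f (M t) \<in> fvec.span G"
    and spanned: "\<forall>u r b c. (\<forall>s<a. embed_matrix n e f (u s) \<in>
        fvec.span (G \<union> (\<lambda>i. outer (b i) (c i)) ` {..<r}))
      \<longrightarrow> slices_spanned n a r u M"
    using ex_clone_space[of a n M] by (elim exE conjE) (rule that)
  obtain H where H: "H \<subseteq> G" "fvec.independent H" "G \<subseteq> fvec.span H"
    using fvec.maximal_independent_subset[of G] by blast
  have finH: "finite H" using H(1) G(1) by (rule finite_subset)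
  have GH: "fvec.span G \<subseteq> fvec.span (H \<union> X)" for X
    using H(3) fvec.span_mono[of H "H \<union> X"] by (metis fvec.span_minimal fvec.subspace_span
        subset_trans sup_ge1)
  obtain h where h: "bij_betw h {..<card H} H"
    using ex_bij_betw_nat_finite[OF finH] by (auto simp: atLeast0LessThan)
  have "\<exists>b c. p = outer b c" if "p \<in> H" for p using G(2) H(1) that by blast
  then obtain bx cx where bc: "\<And>p. p \<in> H \<Longrightarrow> p = outer (bx p) (cx p)" by metis
  define N where "N = a + card H"
  define A where "A = fvec.span ((unit_vec :: nat \<Rightarrow> nat \<Rightarrow> complex) ` {..<N})"
  define B where "B = fvec.span (bx ` H \<union> e ` {..<n})"
  define C where "C = fvec.span (cx ` H \<union> f ` {..<n})"
  \<comment> \<open>The first \<open>a\<close> slices are the embedded matrices of \<open>u\<close>,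
    the remaining ones enumerate \<open>H\<close>.\<close>
  define m where "m s = (if s < a then embed_matrix n e f (u s) else h (s - a))" for s
  define T where "T = (\<Sum>s<N. slab (unit_vec s) (m s))"
  have fd: "fd_space A" "fd_space B" "fd_space C"
    using finH by (auto simp: A_def B_def C_def intro!: fd_space_span)
  then have sub: "fvec.subspace A" by (simp add: fd_space_def)
  have xA: "unit_vec s \<in> A" if "s < N" for s
    using that by (auto simp: A_def intro: fvec.span_base)
  have eB: "e j \<in> B" "f j \<in> C" if "j < n" for j
    using that by (auto simp: B_def C_def intro: fvec.span_base)
  have HBC: "\<exists>b\<in>B. \<exists>c\<in>C. p = outer b c" if "p \<in> H" for p
    using bc[OF that] that unfolding B_def C_def by (meson UnI1 fvec.span_base imageI)
  have m: "m s \<in> H \<or> (\<exists>q<a. m s = embed_matrix n e f (u q))" if "s < N" for s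
    using that h by (auto simp: m_def N_def bij_betw_def)
  have slice: "(\<lambda>p. T (s, p)) = m s" if "s < N" for s
  proof
    fix p
    have "T (s, p) = (\<Sum>s'<N. if s' = s then m s p else 0)"
      unfolding T_def sum_fun_apply by (intro sum.cong refl) (auto simp: slab_def unit_vec_def)
    then show "T (s, p) = m s p" using that by simp
  qed
  \<comment> \<open>For membership any finite rank-one set spanning the slices will do, so all
    products of the e_j and f_k are taken.\<close>
  let ?P = "H \<union> (\<lambda>(j, k). outer (e j) (f k)) ` ({..<n} \<times> {..<n})"
  have TS: "T \<in> tensor_space A B C"
    unfolding T_def
  proof (rule sum_slab_in_tensor_space[OF sub])
    show "finite ?P" using finH by simp
    show "\<exists>b\<in>B. \<exists>c\<in>C. p = outer b c" if "p \<in> ?P" for p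
      using that HBC eB by auto blast
    have "embed_matrix n e f w \<in> fvec.span ?P" for w
      unfolding embed_matrix_def by (intro fvec.span_sum fvec.span_scale fvec.span_base) auto
    then show "unit_vec s \<in> A \<and> m s \<in> fvec.span ?P" if "s \<in> {..<N}" for s
      using m[of s] xA[of s] that by (auto intro: fvec.span_base)
  qed
  have "card H + r < tensor_rank A B C T"
  proof (rule substitution_lower_bound[OF sub TS H(2)])
    fix g assume "g \<in> H"
    then have "g \<in> h ` {..<card H}" using h by (simp add: bij_betw_def)
    then obtain i where "i < card H" "h i = g" by blast
    then show "\<exists>i. g = (\<lambda>p. T (i, p))"
      using slice[of "a + i"] by (intro exI[of _ "a + i"]) (simp add: N_def m_def)
  next
    fix b c :: "nat \<Rightarrow> nat \<Rightarrow> complex"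
    let ?X = "(\<lambda>s. outer (b s) (c s)) ` {..<r}"
    have "\<exists>s<a. embed_matrix n e f (u s) \<notin> fvec.span (G \<union> ?X)"
      using spanned assms by blast
    then obtain s where s: "s < a" "embed_matrix n e f (u s) \<notin> fvec.span (G \<union> ?X)" by blast
    have "fvec.span (H \<union> ?X) \<subseteq> fvec.span (G \<union> ?X)" using H(1) by (intro fvec.span_mono) blast
    then show "\<exists>i. (\<lambda>p. T (i, p)) \<notin> fvec.span (H \<union> ?X)"
      using s slice[of s] by (intro exI[of _ s]) (auto simp: N_def m_def)
  qed
  moreover have "embed_matrix n e f (M q) \<in> fvec.span H" if "q < a" for q
    using G(3) that GH[of "{}"] by auto
  ultimately have "gap_tensor n a r u M A B C N unit_vec m e f H"
    using fd xA eB finH HBC m TS unfolding T_def gap_tensor_def by blast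
  then show ?thesis by blast
qed

section \<open>Direct sums\<close>

definition inl_matrix :: "('j \<times> 'k \<Rightarrow> complex) \<Rightarrow> ('j + 'j') \<times> ('k + 'k') \<Rightarrow> complex" where
  "inl_matrix m = (\<lambda>p. case p of (Inl j, Inl k) \<Rightarrow> m (j, k) | _ \<Rightarrow> 0)"

definition inr_matrix :: "('j' \<times> 'k' \<Rightarrow> complex) \<Rightarrow> ('j + 'j') \<times> ('k + 'k') \<Rightarrow> complex" where
  "inr_matrix m = (\<lambda>p. case p of (Inr j, Inr k) \<Rightarrow> m (j, k) | _ \<Rightarrow> 0)"

lemma inl_tensor_slab: "inl_tensor (slab a m) = slab (inl_vec a) (inl_matrix m)"
  by (auto simp: inl_tensor_def slab_def inl_vec_def inl_matrix_def fun_eq_iff split: sum.splits)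

lemma inr_tensor_slab: "inr_tensor (slab a m) = slab (inr_vec a) (inr_matrix m)"
  by (auto simp: inr_tensor_def slab_def inr_vec_def inr_matrix_def fun_eq_iff split: sum.splits)

lemma inl_tensor_zero: "inl_tensor 0 = 0"
  by (auto simp: inl_tensor_def fun_eq_iff split: sum.splits)

lemma inl_tensor_sum: "inl_tensor (\<Sum>i\<in>I. T i) = (\<Sum>i\<in>I. inl_tensor (T i))"
  by (induction I rule: infinite_finite_induct)
    (simp_all only: sum.infinite sum.empty sum.insert inl_tensor_zero inl_tensor_linear not_False_eq_True)

lemma inr_tensor_zero: "inr_tensor 0 = 0"
  by (auto simp: inr_tensor_def fun_eq_iff split: sum.splits)

lemma inr_tensor_sum: "inr_tensor (\<Sum>i\<in>I. T i) = (\<Sum>i\<in>I. inr_tensor (T i))"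
  by (induction I rule: infinite_finite_induct)
    (simp_all only: sum.infinite sum.empty sum.insert inr_tensor_zero inr_tensor_linear not_False_eq_True)

lemma inl_matrix_linear:
  "inl_matrix 0 = 0" "inl_matrix (m + m') = inl_matrix m + inl_matrix m'"
  "inl_matrix (fscale x m) = fscale x (inl_matrix m)"
  by (auto simp: inl_matrix_def fscale_def fun_eq_iff split: sum.splits)

lemma inr_matrix_linear:
  "inr_matrix 0 = 0" "inr_matrix (m + m') = inr_matrix m + inr_matrix m'"
  "inr_matrix (fscale x m) = fscale x (inr_matrix m)"
  by (auto simp: inr_matrix_def fscale_def fun_eq_iff split: sum.splits)

lemma inl_matrix_sum: "inl_matrix (\<Sum>i\<in>I. m i) = (\<Sum>i\<in>I. inl_matrix (m i))"
  by (induction I rule: infinite_finite_induct)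
    (simp_all only: sum.infinite sum.empty sum.insert inl_matrix_linear not_False_eq_True)

lemma inr_matrix_sum: "inr_matrix (\<Sum>i\<in>I. m i) = (\<Sum>i\<in>I. inr_matrix (m i))"
  by (induction I rule: infinite_finite_induct)
    (simp_all only: sum.infinite sum.empty sum.insert inr_matrix_linear not_False_eq_True)

lemma inl_matrix_outer: "inl_matrix (outer x y) = outer (inl_vec x) (inl_vec y)"
  by (auto simp: inl_matrix_def outer_def inl_vec_def fun_eq_iff split: sum.splits)

lemma inr_matrix_outer: "inr_matrix (outer x y) = outer (inr_vec x) (inr_vec y)"
  by (auto simp: inr_matrix_def outer_def inr_vec_def fun_eq_iff split: sum.splits)

lemma inl_matrix_in_span: "m \<in> fvec.span H \<Longrightarrow> inl_matrix m \<in> fvec.span (inl_matrix ` H)"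
proof (induction rule: fvec.span_induct_alt)
  case base
  show ?case unfolding inl_matrix_linear by (rule fvec.span_zero)
next
  case (step c x y)
  then show ?case unfolding inl_matrix_linear
    by (rule_tac fvec.span_add, rule_tac fvec.span_scale, rule_tac fvec.span_base, rule_tac imageI)
qed

lemma inr_matrix_in_span: "m \<in> fvec.span H \<Longrightarrow> inr_matrix m \<in> fvec.span (inr_matrix ` H)"
proof (induction rule: fvec.span_induct_alt)
  case base
  show ?case unfolding inr_matrix_linear by (rule fvec.span_zero)
next
  case (step c x y)
  then show ?case unfolding inr_matrix_linear
    by (rule_tac fvec.span_add, rule_tac fvec.span_scale, rule_tac fvec.span_base, rule_tac imageI)
qed

lemma dsum_space_memI:
  "fvec.subspace A' \<Longrightarrow> a \<in> A \<Longrightarrow> inl_vec a \<in> dsum_space A A'"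
  "fvec.subspace A \<Longrightarrow> a' \<in> A' \<Longrightarrow> inr_vec a' \<in> dsum_space A A'"
  "a \<in> A \<Longrightarrow> a' \<in> A' \<Longrightarrow> inl_vec a + inr_vec a' \<in> dsum_space A A'"
proof -
  have 0: "inl_vec 0 = 0" "inr_vec 0 = 0" by (auto simp: inl_vec_def inr_vec_def fun_eq_iff split:
      sum.splits)
  show "a \<in> A \<Longrightarrow> a' \<in> A' \<Longrightarrow> inl_vec a + inr_vec a' \<in> dsum_space A A'" for a a'
    unfolding dsum_space_def by blast
  from this[of a 0] this[of 0 a'] show "fvec.subspace A' \<Longrightarrow> a \<in> A \<Longrightarrow> inl_vec a \<in> dsum_space A A'"
    "fvec.subspace A \<Longrightarrow> a' \<in> A' \<Longrightarrow> inr_vec a' \<in> dsum_space A A'"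
    by (simp_all add: 0 fvec.subspace_0)
qed

lemma subspace_dsum_space:
  assumes "fvec.subspace A" "fvec.subspace A'"
  shows "fvec.subspace (dsum_space A A')"
proof (rule fvec.subspaceI)
  have "inl_vec 0 + inr_vec 0 \<in> dsum_space A A'" using assms
    by (intro dsum_space_memI fvec.subspace_0)
  also have "inl_vec 0 + inr_vec 0 = (0 :: 'a + 'b \<Rightarrow> complex)"
    by (auto simp: inl_vec_def inr_vec_def fun_eq_iff split: sum.splits)
  finally show "0 \<in> dsum_space A A'" .
next
  fix x y assume "x \<in> dsum_space A A'" "y \<in> dsum_space A A'"
  then obtain a a' b b' where *: "a \<in> A" "a' \<in> A'" "b \<in> A" "b' \<in> A'"
    "x = inl_vec a + inr_vec a'" "y = inl_vec b + inr_vec b'" unfolding dsum_space_def by blast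
  have "x + y = inl_vec (a + b) + inr_vec (a' + b')"
    by (auto simp: * inl_vec_def inr_vec_def fun_eq_iff split: sum.splits)
  then show "x + y \<in> dsum_space A A'"
    using * assms by (simp add: dsum_space_memI fvec.subspace_add)
next
  fix c x assume "x \<in> dsum_space A A'"
  then obtain a a' where *: "a \<in> A" "a' \<in> A'" "x = inl_vec a + inr_vec a'" unfolding dsum_space_def
      by blast
  have "fscale c x = inl_vec (fscale c a) + inr_vec (fscale c a')"
    by (auto simp: * fscale_def inl_vec_def inr_vec_def fun_eq_iff split: sum.splits)
  then show "fscale c x \<in> dsum_space A A'"
    using * assms by (simp add: dsum_space_memI fvec.subspace_scale)
qed

text \<open>
  The right-hand side involves only \<open>n * n + 2 * n\<close> matrices of rank one: those of the second kind do
  not depend on \<open>k\<close>, those of the third kind do not depend on \<open>j\<close>.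
\<close>

lemma embed_dsum_eq:
  "inl_matrix (embed_matrix n e f m) + inr_matrix (embed_matrix n e' f' (\<lambda>j k. m k j)) =
    (\<Sum>j<n. \<Sum>k<n. fscale (m j k) (outer (inl_vec (e j) + inr_vec (e' k)) (inl_vec (f k) + inr_vec (f' j))
       - outer (inl_vec (e j)) (inr_vec (f' j)) - outer (inr_vec (e' k)) (inl_vec (f k))))"
    (is "?L + ?R = _")
proof -
  have "?R =
    (\<Sum>j<n. \<Sum>k<n. fscale (m j k) (outer (inr_vec (e' k)) (inr_vec (f' j))))"
    unfolding embed_matrix_def inr_matrix_sum inr_matrix_linear inr_matrix_outer by (rule sum.swap)
  moreover have "?L =
    (\<Sum>j<n. \<Sum>k<n. fscale (m j k) (outer (inl_vec (e j)) (inl_vec (f k))))"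
    unfolding embed_matrix_def inl_matrix_sum inl_matrix_linear inl_matrix_outer ..
  ultimately have "?L + ?R =
    (\<Sum>j<n. \<Sum>k<n. fscale (m j k) (outer (inl_vec (e j)) (inl_vec (f k))) +
       fscale (m j k) (outer (inr_vec (e' k)) (inr_vec (f' j))))"
    by (simp only: sum.distrib)
  also have "\<dots> = (\<Sum>j<n. \<Sum>k<n. fscale (m j k)
      (outer (inl_vec (e j) + inr_vec (e' k)) (inl_vec (f k) + inr_vec (f' j))
       - outer (inl_vec (e j)) (inr_vec (f' j)) - outer (inr_vec (e' k)) (inl_vec (f k))))"
    by (intro sum.cong refl) (auto simp: fun_eq_iff fscale_def outer_def algebra_simps)
  finally show ?thesis .
qed

section \<open>Comparison of the ranks\<close>

lemma slices_spanned_transpose: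
  "slices_spanned n a r (\<lambda>q j k. u q k j) (\<lambda>q j k. M q k j) \<longleftrightarrow> slices_spanned n a r u M"
proof -
  have "slices_spanned n a r u M" if "slices_spanned n a r (\<lambda>q j k. u q k j) (\<lambda>q j k. M q k j)" for u M
  proof -
    obtain t x y s where *: "\<forall>q<a. \<forall>j<n. \<forall>k<n.
      u q k j = (\<Sum>i<r. t q i * x i j * y i k) + (\<Sum>p<a. s q p * M p k j)"
      using \<open>slices_spanned n a r (\<lambda>q j k. u q k j) (\<lambda>q j k. M q k j)\<close>
      unfolding slices_spanned_def by blast
    show ?thesis unfolding slices_spanned_def
      using * by (intro exI[of _ t] exI[of _ y] exI[of _ x] exI[of _ s]) (simp add: mult_ac)
  qed
  from this[of u M] this[of "\<lambda>q j k. u q k j" "\<lambda>q j k. M q k j"] show ?thesis by blast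
qed

text \<open>The summands represent \<open>u\<close> modulo \<open>u'\<close> and the transpose of
  \<open>u'\<close> modulo that of \<open>u\<close>. Each rank is at least \<open>r + 1\<close>
  above the number of adjoined slices, while the direct sum needs only n^2 + 2 n matrices beyond the
  adjoined ones.\<close>

lemma strict_subadditivity:
  assumes u: "\<not> slices_spanned n a r u u'" and u': "\<not> slices_spanned n a r u' u"
    and r: "n * n + 2 * n < 2 * r + 2"
  shows "\<exists>(A1 :: (nat \<Rightarrow> complex) set) (B1 :: (nat \<Rightarrow> complex) set) (C1 :: (nat \<Rightarrow> complex) set)
    (A2 :: (nat \<Rightarrow> complex) set) (B2 :: (nat \<Rightarrow> complex) set) (C2 :: (nat \<Rightarrow> complex) set).
     fd_space A1 \<and> fd_space B1 \<and> fd_space C1 \<and> fd_space A2 \<and> fd_space B2 \<and> fd_space C2 \<and>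
     (\<exists>T1 \<in> tensor_space A1 B1 C1. \<exists>T2 \<in> tensor_space A2 B2 C2.
        tensor_rank (dsum_space A1 A2) (dsum_space B1 B2) (dsum_space C1 C2) (dsum_tensor T1 T2)
          < tensor_rank A1 B1 C1 T1 + tensor_rank A2 B2 C2 T2)"
proof -
  let ?tr = "\<lambda>u (q :: nat) j k. u q k j :: complex"
  have tr: "\<not> slices_spanned n a r (?tr u') (?tr u)"
    using u' slices_spanned_transpose[of n a r u' u] by blast
  obtain A1 B1 C1 N1 x1 m1 e1 f1 H1 where "gap_tensor n a r u u' A1 B1 C1 N1 x1 m1 e1 f1 H1"
    using ex_gap_tensor[OF u] by blast
  note 1 = gap_tensorD[OF this]
  obtain A2 B2 C2 N2 x2 m2 e2 f2 H2 where "gap_tensor n a r (?tr u') (?tr u) A2 B2 C2 N2 x2 m2 e2 f2 H2"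
    using ex_gap_tensor[OF tr] by blast
  note 2 = gap_tensorD[OF this]
  have sub: "fvec.subspace A1" "fvec.subspace B1" "fvec.subspace C1"
    "fvec.subspace A2" "fvec.subspace B2" "fvec.subspace C2"
    using 1(1-3) 2(1-3) by (simp_all add: fd_space_def)
  define p :: "nat \<times> nat \<Rightarrow> (nat + nat) \<times> (nat + nat) \<Rightarrow> complex"
      where "p = (\<lambda>(j, k). outer (inl_vec (e1 j) + inr_vec (e2 k)) (inl_vec (f1 k) + inr_vec (f2 j)))"
  define q :: "nat \<Rightarrow> (nat + nat) \<times> (nat + nat) \<Rightarrow> complex"
      where "q j = outer (inl_vec (e1 j)) (inr_vec (f2 j))" for j
  define q' :: "nat \<Rightarrow> (nat + nat) \<times> (nat + nat) \<Rightarrow> complex"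
      where "q' k = outer (inr_vec (e2 k)) (inl_vec (f1 k))" for k
  \<comment> \<open>The three families that serve all pairs of a matrix and its transpose, with the
    adjoined slices of both summands.\<close>
  define P where "P = p ` ({..<n} \<times> {..<n}) \<union> q ` {..<n} \<union> q' ` {..<n} \<union> inl_matrix ` H1 \<union> inr_matrix ` H2"
  have "card P \<le> card (p ` ({..<n} \<times> {..<n})) + card (q ` {..<n}) + card (q' ` {..<n}) +
      card (inl_matrix ` H1 :: ((nat + nat) \<times> (nat + nat) \<Rightarrow> complex) set) +
          card (inr_matrix ` H2 :: ((nat + nat) \<times> (nat + nat) \<Rightarrow> complex) set)"
    unfolding P_def by (intro card_Un_le[THEN order_trans] add_mono order_refl)
  also have "\<dots> \<le> card ({..<n} \<times> {..<n}) + card {..<n} + card {..<n} + card H1 + card H2"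
    by (intro add_mono card_image_le 1(7) 2(7)) auto
  finally have cardP: "card P \<le> n * n + 2 * n + card H1 + card H2" by simp
  have pair: "inl_matrix (embed_matrix n e1 f1 w) +
      inr_matrix (embed_matrix n e2 f2 (\<lambda>j k. w k j)) \<in> fvec.span P" for w :: "nat \<Rightarrow> nat \<Rightarrow> complex"
    unfolding embed_dsum_eq
  proof (intro fvec.span_sum fvec.span_scale fvec.span_diff fvec.span_base)
    fix j k assume "j \<in> {..<n}" "k \<in> {..<n}"
    then have "p (j, k) \<in> P" "q j \<in> P" "q' k \<in> P" unfolding P_def by blast+
    then show "outer (inl_vec (e1 j) + inr_vec (e2 k)) (inl_vec (f1 k) + inr_vec (f2 j)) \<in> P"
      "outer (inl_vec (e1 j)) (inr_vec (f2 j)) \<in> P" "outer (inr_vec (e2 k)) (inl_vec (f1 k)) \<in> P"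
      by (simp_all add: p_def q_def q'_def)
  qed
  have inl: "inl_matrix m \<in> fvec.span P" if "m \<in> fvec.span H1" for m
    using inl_matrix_in_span[OF that] fvec.span_mono[of "inl_matrix ` H1" P] unfolding P_def by blast
  have inr: "inr_matrix m \<in> fvec.span P" if "m \<in> fvec.span H2" for m
    using inr_matrix_in_span[OF that] fvec.span_mono[of "inr_matrix ` H2" P] unfolding P_def by blast
  have m1: "inl_matrix (m1 s) \<in> fvec.span P" if "s < N1" for s
    using 1(9)[rule_format, OF that]
  proof
    assume "\<exists>q<a. m1 s = embed_matrix n e1 f1 (u q)"
    then obtain i where i: "i < a" "m1 s = embed_matrix n e1 f1 (u i)" by blast
    \<comment> \<open>The transpose of \<open>u i\<close> is embedded into the span of
      \<open>H2\<close>; subtracting it from the pair leaves the first component.\<close>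
    show ?thesis
      using fvec.span_diff[OF pair[of "u i"] inr[OF 2(10)[rule_format, OF i(1)]]] by (simp add: i)
  qed (intro inl fvec.span_base)
  have m2: "inr_matrix (m2 s) \<in> fvec.span P" if "s < N2" for s
    using 2(9)[rule_format, OF that]
  proof
    assume "\<exists>q<a. m2 s = embed_matrix n e2 f2 (?tr u' q)"
    then obtain i where i: "i < a" "m2 s = embed_matrix n e2 f2 (?tr u' i)" by blast
    show ?thesis
      using fvec.span_diff[OF pair[of "u' i"] inl[OF 1(10)[rule_format, OF i(1)]]] by (simp add: i)
  qed (intro inr fvec.span_base)
  let ?T1 = "\<Sum>s<N1. slab (x1 s) (m1 s)"
  let ?T2 = "\<Sum>s<N2. slab (x2 s) (m2 s)"
  let ?x = "case_sum (inl_vec \<circ> x1) (inr_vec \<circ> x2)"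
  let ?m = "case_sum (inl_matrix \<circ> m1) (inr_matrix \<circ> m2)"
  have "tensor_rank (dsum_space A1 A2) (dsum_space B1 B2) (dsum_space C1 C2)
      (\<Sum>i\<in>{..<N1} <+> {..<N2}. slab (?x i) (?m i)) \<le> card P"
  proof (rule tensor_rank_sum_slab_le)
    show "fvec.subspace (dsum_space A1 A2)" using sub by (intro subspace_dsum_space)
    show "finite P" using 1(7) 2(7) by (simp add: P_def)
    show "\<exists>b\<in>dsum_space B1 B2. \<exists>c\<in>dsum_space C1 C2. z = outer b c" if "z \<in> P" for z
    proof -
      have *: ?thesis if "z = outer b c" "b \<in> dsum_space B1 B2" "c \<in> dsum_space C1 C2" for b c
        using that by blast
      from \<open>z \<in> P\<close> consider j k where "j < n" "k < n" "z = p (j, k)"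
        | j where "j < n" "z = q j" | k where "k < n" "z = q' k"
        | m where "m \<in> H1" "z = inl_matrix m" | m where "m \<in> H2" "z = inr_matrix m"
        unfolding P_def by blast
      then show ?thesis
      proof cases
        case 4
        then obtain b c where "b \<in> B1" "c \<in> C1" "m = outer b c" using 1(8) by blast
        with 4 show ?thesis using sub by (intro *[of "inl_vec b" "inl_vec c"]) (auto simp:
            inl_matrix_outer intro: dsum_space_memI)
      next
        case 5
        then obtain b c where "b \<in> B2" "c \<in> C2" "m = outer b c" using 2(8) by blast
        with 5 show ?thesis using sub by (intro *[of "inr_vec b" "inr_vec c"]) (auto simp:
            inr_matrix_outer intro: dsum_space_memI)
      qed (auto simp: p_def q_def q'_def intro!: * dsum_space_memI sub 1(5,6)[rule_format]
          2(5,6)[rule_format])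
    qed
    show "?x i \<in> dsum_space A1 A2 \<and> ?m i \<in> fvec.span P" if "i \<in> {..<N1} <+> {..<N2}" for i
      using that by (auto intro!: dsum_space_memI sub 1(4)[rule_format] 2(4)[rule_format] m1 m2)
  qed
  also have "(\<Sum>i\<in>{..<N1} <+> {..<N2}. slab (?x i) (?m i)) = dsum_tensor ?T1 ?T2"
    by (simp add: sum.Plus dsum_tensor_def inl_tensor_sum inr_tensor_sum inl_tensor_slab inr_tensor_slab)
  finally have "tensor_rank (dsum_space A1 A2) (dsum_space B1 B2) (dsum_space C1 C2) (dsum_tensor ?T1 ?T2)
      < tensor_rank A1 B1 C1 ?T1 + tensor_rank A2 B2 C2 ?T2"
    using cardP r 1(12) 2(12) by linarith
  then show ?thesis using 1(1-3,11) 2(1-3,11) by blast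
qed

theorem theorem1p2:
  "\<exists>(A1 :: (nat \<Rightarrow> complex) set) (B1 :: (nat \<Rightarrow> complex) set) (C1 :: (nat \<Rightarrow> complex) set)
    (A2 :: (nat \<Rightarrow> complex) set) (B2 :: (nat \<Rightarrow> complex) set) (C2 :: (nat \<Rightarrow> complex) set).
     fd_space A1 \<and> fd_space B1 \<and> fd_space C1 \<and> fd_space A2 \<and> fd_space B2 \<and> fd_space C2 \<and>
     (\<exists>T1 \<in> tensor_space A1 B1 C1. \<exists>T2 \<in> tensor_space A2 B2 C2.
        tensor_rank (dsum_space A1 A2) (dsum_space B1 B2) (dsum_space C1 C2) (dsum_tensor T1 T2)
          < tensor_rank A1 B1 C1 T1 + tensor_rank A2 B2 C2 T2)"
proof -
  txt \<open>The dimension count needs \<open>a r + 2 r n + a\<^sup>2 < a n\<^sup>2\<close>, with \<open>2 r + 2 > n\<^sup>2 + 2 n\<close>.\<close>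
  obtain u u' where "\<not> slices_spanned 30 100 480 u u'" "\<not> slices_spanned 30 100 480 u' u"
    using ex_not_slices_spanned[where 'a = 100 and 'r = 480 and 'n = 30] by auto
  \<comment> \<open>Numerically 48000 + 28800 + 10000 = 86800 < 90000 for the dimensions, and 960 <
    962 for the ranks.\<close>
  then show ?thesis by (rule strict_subadditivity) simp
qed

end
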